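(* Let $w$ be either the empty word or a word in the letters $x_0,x_1$ ending in $x_1$, and let $s\ge3$ be an integer. Then $$\sum_{n=1}^\infty\frac{H_{n-1}(w)}{n^s}\left[4^{-n}\binom{2n}{n}\right]^{-2}\in\mathsf{CMZV}^4_{s+|w|}.$$
   Context: A nonempty word ending in $x_1$ can be written uniquely as $w=x_0^{t_1-1}x_1\cdots x_0^{t_k-1}x_1$ with $t_j$ positive integers; its weight is $|w|=t_1+\cdots+t_k$, and $H_M(w)=\sum_{M\ge m_1>\cdots>m_k\ge1}\frac{1}{m_1^{t_1}\cdots m_k^{t_k}}$ for $M\ge0$ (so $H_0(w)=0$). For the empty word, $|w|=0$ and $H_M(w)=1$. For positive integers $s_1,\dots,s_k$ and complex $a_j$, $L_{s_1,\dots,s_k}(a_1,\dots,a_k)=\sum_{n_1>\cdots>n_k\ge1}\frac{a_1^{n_1}\cdots a_k^{n_k}}{n_1^{s_1}\cdots n_k^{s_k}}$. For integers $N\ge1$, $W\ge1$, $\mathsf{CMZV}^N_W$ is the $\mathbb{Q}$-linear span of all $L_{s_1,\dots,s_k}(a_1,\dots,a_k)$ with $k\ge1$, $s_1+\cdots+s_k=W$, each $a_j$ an $N$-th root of unity, and $(s_1,a_1)\ne(1,1)$. *)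

theory Defs
  imports "HOL-Analysis.Analysis"
begin

datatype letter = X0 | X1

definition admissible_word :: "letter list \<Rightarrow> bool" where
  "admissible_word w \<longleftrightarrow> w = [] \<or> last w = X1"

text \<open>Decomposition w = x0^(t1-1) x1 ... x0^(tk-1) x1 into the exponent list [t1,...,tk].\<close>
fun comp_aux :: "nat \<Rightarrow> letter list \<Rightarrow> nat list" where
  "comp_aux c [] = []"
| "comp_aux c (X0 # w) = comp_aux (Suc c) w"
| "comp_aux c (X1 # w) = Suc c # comp_aux 0 w"

definition word_comp :: "letter list \<Rightarrow> nat list" where
  "word_comp w = comp_aux 0 w"

definition weight :: "letter list \<Rightarrow> nat" where
  "weight w = sum_list (word_comp w)"

definition Hsum :: "nat \<Rightarrow> letter list \<Rightarrow> complex" where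
  "Hsum M w = (let ts = word_comp w in
     (\<Sum>ms\<in>{ms. length ms = length ts \<and> sorted_wrt (>) ms \<and> set ms \<subseteq> {1..M}}.
        \<Prod>i<length ts. 1 / (of_nat (ms ! i)) ^ (ts ! i)))"

definition Ltrunc :: "nat \<Rightarrow> nat list \<Rightarrow> complex list \<Rightarrow> complex" where
  "Ltrunc N ss as = (\<Sum>ns\<in>{ns. length ns = length ss \<and> sorted_wrt (>) ns \<and> set ns \<subseteq> {1..N}}.
        \<Prod>i<length ss. (as ! i) ^ (ns ! i) / (of_nat (ns ! i)) ^ (ss ! i))"

definition Lpoly :: "nat list \<Rightarrow> complex list \<Rightarrow> complex" where
  "Lpoly ss as = lim (\<lambda>N. Ltrunc N ss as)"

definition cmzv_gens :: "nat \<Rightarrow> nat \<Rightarrow> complex set" where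
  "cmzv_gens N W = {Lpoly ss as | ss as.
      ss \<noteq> [] \<and> length as = length ss \<and> (\<forall>s\<in>set ss. s \<ge> 1) \<and> sum_list ss = W \<and>
      (\<forall>a\<in>set as. a ^ N = 1) \<and> (hd ss, hd as) \<noteq> (1, 1)}"

definition CMZV :: "nat \<Rightarrow> nat \<Rightarrow> complex set" where
  "CMZV N W = {z. \<exists>S c. finite S \<and> S \<subseteq> cmzv_gens N W \<and>
      z = (\<Sum>g\<in>S. of_real (of_rat (c g)) * g)}"

end

theory Submission
  imports Defs
begin

text \<open>
  Write \<open>b(n) = 4^n / binom(2n,n)\<close> and \<open>f(s,w)(y) = sum H_{n-1}(w) b(n) y^n / n^s\<close>.
  Substituting \<open>y = sin\<^sup>2 \<theta>\<close>, the relation \<open>(2n+1) b(n+1) = (2n+2) b(n)\<close> gives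
  \<open>df(s,w) = 2 cot \<theta> f(s-1,w) d\<theta>\<close> for \<open>s \<ge> 2\<close>, while \<open>f(1,w) = 2 tan \<theta> E(w)\<close> with
  \<open>dE(w) = f(w) d\<theta>\<close>. So \<open>f(s,w)\<close> with \<open>s \<ge> 2\<close> is an iterated integral of the forms
  \<open>cot \<theta> d\<theta>\<close>, \<open>tan \<theta> d\<theta>\<close> and an even number of \<open>d\<theta>\<close>. In the variable \<open>t = tan (\<theta>/2)\<close> these
  are combinations of \<open>dt/t\<close> and \<open>a dt/(1 - a t)\<close> with \<open>a^4 = 1\<close>, rational except for a
  factor \<open>\<i>\<close> in each \<open>d\<theta>\<close>. The second factor \<open>b(n) = 2n \<integral> sin\<^bsup>2n-1\<^esup> \<theta> d\<theta>\<close> over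
  \<open>[0, \<pi>/2]\<close> turns the sum into an integral of \<open>2 f(s-1,w) dt/t\<close> over \<open>[0, 1]\<close>, because
  \<open>d\<theta> / sin \<theta> = dt/t\<close>. Expanding this iterated integral into its power series at
  \<open>t = 1\<close> yields level 4 multiple polylogarithms with leading exponent at least 2.
\<close>

section \<open>Nested sums\<close>

abbreviation decr_lists :: "nat \<Rightarrow> nat \<Rightarrow> nat list set" where
  "decr_lists k M \<equiv> {ms. length ms = k \<and> sorted_wrt (>) ms \<and> set ms \<subseteq> {1..M}}"

lemma finite_decr_lists: "finite (decr_lists k M)"
  by (rule finite_subset[OF _ finite_lists_length_eq[of "{1..M}" k]]) auto

text \<open>The head of a decreasing list is its largest entry n, and the tail is an arbitrary
  decreasing list with entries at most n - 1. Iterating this turns nested sums into the recursion of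
  \<open>lseq\<close>.\<close>

lemma sum_decr_lists_Suc:
  fixes F :: "nat \<Rightarrow> nat \<Rightarrow> 'a::comm_semiring_1"
  shows "(\<Sum>ms\<in>decr_lists (Suc k) M. \<Prod>i<Suc k. F i (ms ! i)) =
    (\<Sum>n\<in>{1..M}. F 0 n * (\<Sum>ms\<in>decr_lists k (n - 1). \<Prod>i<k. F (Suc i) (ms ! i)))"
proof -
  let ?S = "SIGMA n:{1..M}. decr_lists k (n - 1)"
  have inj: "inj_on (\<lambda>(n, ms). n # ms) ?S"
    by (auto simp: inj_on_def)
  have img: "(\<lambda>(n, ms). n # ms) ` ?S = decr_lists (Suc k) M"
  proof (intro equalityI subsetI)
    fix ms assume ms: "ms \<in> decr_lists (Suc k) M"
    then obtain n ns where ns: "ms = n # ns" by (auto simp: length_Suc_conv)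
    have "ns \<in> decr_lists k (n - 1)"
      using ms ns by force
    with ms ns show "ms \<in> (\<lambda>(n, ms). n # ms) ` ?S" by force
  next
    fix ms assume "ms \<in> (\<lambda>(n, ms). n # ms) ` ?S"
    then obtain n ns where *: "ms = n # ns" "n \<in> {1..M}" "ns \<in> decr_lists k (n - 1)" by auto
    have "\<And>y. y \<in> set ns \<Longrightarrow> 1 \<le> y \<and> y < n" using *(2,3) by fastforce
    then show "ms \<in> decr_lists (Suc k) M" using * by fastforce
  qed
  have "(\<Sum>ms\<in>decr_lists (Suc k) M. \<Prod>i<Suc k. F i (ms ! i)) =
      (\<Sum>(n, ms)\<in>?S. \<Prod>i<Suc k. F i ((n # ms) ! i))"
    by (subst img[symmetric], subst sum.reindex[OF inj]) (simp add: case_prod_unfold)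
  also have "\<dots> = (\<Sum>(n, ms)\<in>?S. F 0 n * (\<Prod>i<k. F (Suc i) (ms ! i)))"
    by (simp add: prod.lessThan_Suc_shift del: prod.lessThan_Suc)
  also have "\<dots> = (\<Sum>n\<in>{1..M}. \<Sum>ms\<in>decr_lists k (n - 1). F 0 n * (\<Prod>i<k. F (Suc i) (ms ! i)))"
    by (subst sum.Sigma) (use finite_decr_lists in auto)
  finally show ?thesis by (simp add: sum_distrib_left)
qed

text \<open>\<open>lseq [(s1, a1), \<dots>] n\<close> collects the terms of the multiple polylogarithm with
  outermost index \<open>n\<close>. For the empty list it is concentrated at 0, so that partial sums
  equal 1.\<close>

fun lseq :: "(nat \<times> complex) list \<Rightarrow> nat \<Rightarrow> complex" where
  "lseq [] n = (if n = 0 then 1 else 0)"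
| "lseq ((s, a) # l) n = a ^ n / of_nat n ^ s * (\<Sum>m<n. lseq l m)"

lemma Ltrunc_eq_sum_lseq: "Ltrunc N (map fst l) (map snd l) = (\<Sum>n\<le>N. lseq l n)"
proof (induction l arbitrary: N)
  case Nil
  have "{ns::nat list. ns = [] \<and> sorted_wrt (>) ns \<and> set ns \<subseteq> {1..N}} = {[]}" by auto
  then show ?case by (simp add: Ltrunc_def sum.delta)
next
  case (Cons p l)
  obtain s a where p: "p = (s, a)" by (cases p)
  define F where "F i n = (map snd (p # l) ! i) ^ n / (of_nat n) ^ (map fst (p # l) ! i)"
    for i n :: nat
  have "Ltrunc N (map fst (p # l)) (map snd (p # l)) =
      (\<Sum>ms\<in>decr_lists (Suc (length l)) N. \<Prod>i<Suc (length l). F i (ms ! i))"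
    unfolding Ltrunc_def F_def by simp
  also have "\<dots> = (\<Sum>n\<in>{1..N}. F 0 n * Ltrunc (n - 1) (map fst l) (map snd l))"
    by (subst sum_decr_lists_Suc) (simp add: Ltrunc_def F_def)
  also have "\<dots> = (\<Sum>n\<in>{1..N}. lseq (p # l) n)"
  proof (rule sum.cong)
    fix n assume "n \<in> {1..N}"
    then have "{..n - 1} = {..<n}" by auto
    then show "F 0 n * Ltrunc (n - 1) (map fst l) (map snd l) = lseq (p # l) n"
      by (simp add: F_def p Cons.IH)
  qed simp
  \<comment> \<open>The extra index 0 contributes nothing, since its inner sum is empty.\<close>
  also have "\<dots> = (\<Sum>n\<le>N. lseq (p # l) n)"
    by (rule sum.mono_neutral_left) (auto simp: p not_less_eq_eq)
  finally show ?case .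
qed

text \<open>For \<open>ts = word_comp w\<close> and n >= 1, \<open>hseq (s # ts) n\<close> is
  H_{n-1}(w) / n^s. It is real-valued because the generating functions built from it are
  differentiated along the real line.\<close>

fun hseq :: "nat list \<Rightarrow> nat \<Rightarrow> real" where
  "hseq [] n = (if n = 0 then 1 else 0)"
| "hseq (s # ts) n = (\<Sum>m<n. hseq ts m) / real n ^ s"

lemma lseq_ones: "lseq (map (\<lambda>t. (t, 1)) ts) n = of_real (hseq ts n)"
  by (induction ts arbitrary: n) auto

lemma Hsum_eq_sum_hseq: "Hsum M w = of_real (\<Sum>n\<le>M. hseq (word_comp w) n)"
proof -
  let ?l = "map (\<lambda>t. (t, 1::complex)) (word_comp w)"
  have "Hsum M w = Ltrunc M (map fst ?l) (map snd ?l)"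
    unfolding Hsum_def Ltrunc_def Let_def
    by (intro sum.cong prod.cong) (auto simp: o_def)
  then show ?thesis
    by (simp only: Ltrunc_eq_sum_lseq lseq_ones of_real_sum)
qed

lemma hseq_nonneg: "hseq ts n \<ge> 0"
  by (induction ts arbitrary: n) (auto intro!: divide_nonneg_nonneg sum_nonneg)

lemma comp_aux_pos: "t \<in> set (comp_aux c w) \<Longrightarrow> t \<ge> 1"
  by (induction c w rule: comp_aux.induct) auto

section \<open>Growth of coefficient sequences\<close>

text \<open>The exponent 1/2 is chosen because the bound is preserved by nested summation,
  and \<open>slow a\<close> makes \<open>a n / n\<close> absolutely summable.\<close>

definition slow :: "(nat \<Rightarrow> 'a::real_normed_vector) \<Rightarrow> bool" where
  "slow a \<longleftrightarrow> (\<exists>C. \<forall>n. norm (a n) \<le> C / sqrt (Suc n))"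

lemma sum_inverse_sqrt_le: "(\<Sum>m<n. 1 / sqrt (real (Suc m))) \<le> 2 * sqrt n"
proof (induction n)
  case (Suc n)
  have "1 / sqrt (real (Suc n)) \<le> 2 * sqrt (Suc n) - 2 * sqrt n"
  proof -
    have "2 * sqrt n * sqrt (Suc n) \<le> real n + real (Suc n)"
      using sum_squares_bound[of "sqrt n" "sqrt (Suc n)"] by simp
    then show ?thesis by (simp add: field_simps)
  qed
  with Suc show ?case by simp
qed simp

lemma slow_partial_sums:
  assumes "slow a"
  obtains C where "C \<ge> 0" "\<And>n. norm (\<Sum>m<n. a m) \<le> C * sqrt n"
proof -
  obtain C where C: "\<And>n. norm (a n) \<le> C / sqrt (Suc n)" using assms by (auto simp: slow_def)
  have C0: "C \<ge> 0" using order_trans[OF norm_ge_zero C[of 0]] by simp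
  have "norm (\<Sum>m<n. a m) \<le> (2 * C) * sqrt n" for n
  proof -
    have "norm (\<Sum>m<n. a m) \<le> (\<Sum>m<n. C * (1 / sqrt (Suc m)))"
      using C by (intro sum_norm_le) simp
    also have "\<dots> = C * (\<Sum>m<n. 1 / sqrt (Suc m))" by (simp only: sum_distrib_left)
    also have "\<dots> \<le> C * (2 * sqrt n)" using sum_inverse_sqrt_le C0 by (intro mult_left_mono) auto
    finally show ?thesis by simp
  qed
  with C0 show ?thesis by (intro that[of "2 * C"]) auto
qed

text \<open>Partial sums of a slow sequence are of order sqrt n, and dividing by n^s with s >= 1
  restores the order 1 / sqrt n. The factor \<open>v\<close> stands for powers of a root of
  unity.\<close>

lemma slow_nested:
  fixes a :: "nat \<Rightarrow> 'a::real_normed_field"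
  assumes "slow a" "s \<ge> 1" "\<And>n. norm (v n) \<le> 1"
  shows "slow (\<lambda>n. v n / of_nat n ^ s * (\<Sum>m<n. a m))"
proof -
  obtain C where C: "C \<ge> 0" "\<And>n. norm (\<Sum>m<n. a m) \<le> C * sqrt n"
    using slow_partial_sums[OF assms(1)] by blast
  show ?thesis unfolding slow_def
  proof (intro exI allI)
    fix n
    show "norm (v n / of_nat n ^ s * (\<Sum>m<n. a m)) \<le> 2 * C / sqrt (Suc n)"
    proof (cases "n = 0")
      case True
      then show ?thesis using C by simp
    next
      case False
      have "real n \<le> real n ^ s" using False assms(2) by (intro self_le_power) auto
      then have "norm (v n) / real n ^ s \<le> 1 / real n"
        using False assms(3)[of n] by (intro frac_le) auto
      then have "norm (v n / of_nat n ^ s * (\<Sum>m<n. a m)) \<le> (1 / n) * (C * sqrt n)"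
        unfolding norm_mult norm_divide norm_power norm_of_nat
        using C by (intro mult_mono) auto
      also have "\<dots> = C * (1 / sqrt n)"
        using False by (simp add: field_simps real_sqrt_mult_self flip: mult.assoc)
      also have "\<dots> \<le> C * (2 / sqrt (Suc n))"
      proof -
        \<comment> \<open>The factor 2 in the bound pays for replacing n by n + 1.\<close>
        have "sqrt (Suc n) \<le> sqrt (4 * n)" using False by (intro real_sqrt_le_mono) simp
        then have "1 / sqrt n \<le> 2 / sqrt (Suc n)" using False by (simp add: field_simps real_sqrt_mult)
        with C show ?thesis by (intro mult_left_mono) auto
      qed
      finally show ?thesis by (simp add: mult.commute)
    qed
  qed
qed

lemma slow_add: "slow a \<Longrightarrow> slow b \<Longrightarrow> slow (\<lambda>n. a n + b n)"
  unfolding slow_def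
proof (elim exE)
  fix C D assume "\<forall>n. norm (a n) \<le> C / sqrt (Suc n)" "\<forall>n. norm (b n) \<le> D / sqrt (Suc n)"
  then have "norm (a n + b n) \<le> (C + D) / sqrt (Suc n)" for n
    by (metis (no_types, lifting) add_divide_distrib add_mono norm_triangle_le)
  then show "\<exists>C. \<forall>n. norm (a n + b n) \<le> C / sqrt (Suc n)" by blast
qed

lemma slow_cmult:
  fixes a :: "nat \<Rightarrow> 'a::real_normed_field"
  shows "slow a \<Longrightarrow> slow (\<lambda>n. c * a n)"
  unfolding slow_def
proof (elim exE)
  fix C assume "\<forall>n. norm (a n) \<le> C / sqrt (Suc n)"
  then have "norm (c * a n) \<le> (norm c * C) / sqrt (Suc n)" for n
    by (metis mult_left_mono norm_ge_zero norm_mult times_divide_eq_right)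
  then show "\<exists>C. \<forall>n. norm (c * a n) \<le> C / sqrt (Suc n)" by blast
qed

lemma slow_delta: "slow (\<lambda>n. if n = 0 then 1 else (0::'a::real_normed_field))"
  unfolding slow_def by (intro exI[of _ 1]) auto

lemma slow_hseq: "(\<forall>t\<in>set ts. t \<ge> 1) \<Longrightarrow> slow (hseq ts)"
proof (induction ts)
  case Nil
  then show ?case using slow_delta[where 'a=real] by simp
next
  case (Cons s ts)
  then show ?case using slow_nested[of "hseq ts" s "\<lambda>_. 1"] by simp
qed

lemma slow_lseq:
  "(\<forall>(s, a)\<in>set l. s \<ge> 1 \<and> norm a = 1) \<Longrightarrow> slow (lseq l)"
proof (induction l)
  case Nil
  then show ?case using slow_delta[where 'a=complex] by simp
next
  case (Cons p l)
  obtain s a where p: "p = (s, a)" by (cases p)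
  show ?case using slow_nested[of "lseq l" s "\<lambda>n. a ^ n"] Cons
    by (simp add: p norm_power)
qed

lemma summable_Suc_powr: "summable (\<lambda>n. C / (real (Suc n) * sqrt (real (Suc n))))"
proof -
  have "summable (\<lambda>n. real n powr (-3/2))" by (simp add: summable_real_powr_iff)
  then have "summable (\<lambda>n. C * real (Suc n) powr (-3/2))"
    by (subst (asm) summable_Suc_iff[symmetric]) (rule summable_mult)
  moreover have "C * real (Suc n) powr (-3/2) = C / (real (Suc n) * sqrt (real (Suc n)))" for n
  proof -
    have "real (Suc n) powr (3/2) = real (Suc n) powr (1 + 1/2)" by simp
    also have "\<dots> = real (Suc n) * sqrt (real (Suc n))"
      by (subst powr_add) (simp add: powr_half_sqrt)
    finally show ?thesis using powr_minus_divide[of "real (Suc n)" "3/2"] by simp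
  qed
  ultimately show ?thesis by (simp only:)
qed

lemma slow_imp_summable_div:
  fixes a :: "nat \<Rightarrow> 'a::{real_normed_field, banach}"
  assumes "slow a"
  shows "summable (\<lambda>n. norm (a n / of_nat n))"
proof -
  obtain C where C: "\<And>n. norm (a n) \<le> C / sqrt (Suc n)" using assms by (auto simp: slow_def)
  have C0: "C \<ge> 0" using order_trans[OF norm_ge_zero C[of 0]] by simp
  have "norm (norm (a (Suc n) / of_nat (Suc n))) \<le> C / (real (Suc n) * sqrt (Suc n))" for n
  proof -
    have "norm (a (Suc n)) \<le> C / sqrt (Suc (Suc n))" by (rule C)
    also have "\<dots> \<le> C / sqrt (Suc n)" using C0 by (intro divide_left_mono) auto
    finally have "norm (a (Suc n)) / Suc n \<le> (C / sqrt (Suc n)) / Suc n"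
      by (intro divide_right_mono) auto
    then show ?thesis by (simp add: norm_divide mult.commute del: of_nat_Suc)
  qed
  then have "summable (\<lambda>n. norm (a (Suc n) / of_nat (Suc n)))"
    by (intro summable_comparison_test[OF _ summable_Suc_powr[of C]]) blast
  then show ?thesis by (subst summable_Suc_iff[symmetric])
qed

section \<open>Closure of \<open>CMZV\<close> under rational linear combinations\<close>

lemma CMZV_gen: "g \<in> cmzv_gens N W \<Longrightarrow> g \<in> CMZV N W"
  unfolding CMZV_def by (intro CollectI exI[of _ "{g}"] exI[of _ "\<lambda>_. 1"]) auto

lemma CMZV_scale: "z \<in> CMZV N W \<Longrightarrow> of_real (of_rat q) * z \<in> CMZV N W"
proof -
  assume "z \<in> CMZV N W"
  then obtain S c where S: "finite S" "S \<subseteq> cmzv_gens N W"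
    and z: "z = (\<Sum>g\<in>S. of_real (of_rat (c g)) * g)"
    by (auto simp: CMZV_def)
  have "of_real (of_rat q) * z = (\<Sum>g\<in>S. of_real (of_rat (q * c g)) * g)"
    by (simp add: z sum_distrib_left of_rat_mult mult.assoc)
  with S show ?thesis unfolding CMZV_def
    by (intro CollectI exI[of _ S] exI[of _ "\<lambda>g. q * c g"]) simp
qed

lemma CMZV_add: "z \<in> CMZV N W \<Longrightarrow> z' \<in> CMZV N W \<Longrightarrow> z + z' \<in> CMZV N W"
proof -
  assume "z \<in> CMZV N W" "z' \<in> CMZV N W"
  then obtain S c S' c' where S: "finite S" "S \<subseteq> cmzv_gens N W" "finite S'" "S' \<subseteq> cmzv_gens N W"
    and z: "z = (\<Sum>g\<in>S. of_real (of_rat (c g)) * g)" "z' = (\<Sum>g\<in>S'. of_real (of_rat (c' g)) * g)"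
    unfolding CMZV_def by blast
  \<comment> \<open>The two generating sets may overlap, so both coefficient functions are extended
    by 0 to the union.\<close>
  define d where "d g = (if g \<in> S then c g else 0) + (if g \<in> S' then c' g else 0)" for g
  have "z = (\<Sum>g\<in>S \<union> S'. of_real (of_rat (if g \<in> S then c g else 0)) * g)"
    unfolding z using S by (intro sum.mono_neutral_cong_left) auto
  moreover have "z' = (\<Sum>g\<in>S \<union> S'. of_real (of_rat (if g \<in> S' then c' g else 0)) * g)"
    unfolding z using S by (intro sum.mono_neutral_cong_left) auto
  ultimately have "z + z' = (\<Sum>g\<in>S \<union> S'. of_real (of_rat (d g)) * g)"
    unfolding d_def by (simp only: of_rat_add of_real_add distrib_right sum.distrib)
  with S show ?thesis unfolding CMZV_def
    by (intro CollectI exI[of _ "S \<union> S'"] exI[of _ d]) simp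
qed

section \<open>The rational span of the coefficient sequences\<close>

text \<open>The first argument is the weight. A leading pair \<open>(1, 1)\<close> is allowed,
  because values at 1 are taken only after a final \<open>int0\<close>, which makes the leading
  exponent at least 2.\<close>

inductive lspan :: "nat \<Rightarrow> (nat \<Rightarrow> complex) \<Rightarrow> bool" where
  gen: "(\<forall>(s, a)\<in>set l. s \<ge> 1 \<and> a ^ 4 = 1) \<Longrightarrow> lspan (sum_list (map fst l)) (lseq l)"
| add: "lspan W p \<Longrightarrow> lspan W q \<Longrightarrow> lspan W (\<lambda>n. p n + q n)"
| scale: "lspan W p \<Longrightarrow> lspan W (\<lambda>n. of_real (of_rat c) * p n)"

lemma norm_eq_1_of_power4:
  fixes a :: complex
  shows "a ^ 4 = 1 \<Longrightarrow> norm a = 1"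
proof -
  assume "a ^ 4 = 1"
  then have "norm a ^ 4 = 1 ^ 4" by (simp flip: norm_power)
  then show ?thesis by (rule power_eq_imp_eq_base) auto
qed

lemma lspan_slow: "lspan W p \<Longrightarrow> slow p"
proof (induction rule: lspan.induct)
  case (gen l)
  then show ?case by (intro slow_lseq) (auto intro: norm_eq_1_of_power4)
qed (auto intro: slow_add slow_cmult)

text \<open>Positive weight forces a nonempty list, whose inner sum at index 0 is empty. The empty
  list, of weight 0, gives the value 1 there.\<close>

lemma lspan_at_0: "lspan W p \<Longrightarrow> W \<ge> 1 \<Longrightarrow> p 0 = 0"
proof (induction rule: lspan.induct)
  case (gen l)
  then show ?case by (cases l) auto
qed auto

text \<open>On power series, \<open>int0\<close> is integration against \<open>dz/z\<close> and \<open>int1 a\<close> is integration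
  against \<open>a dz/(1 - a z)\<close>.\<close>

definition int0 :: "(nat \<Rightarrow> complex) \<Rightarrow> nat \<Rightarrow> complex" where
  "int0 p n = p n / of_nat n"

definition int1 :: "complex \<Rightarrow> (nat \<Rightarrow> complex) \<Rightarrow> nat \<Rightarrow> complex" where
  "int1 a p n = a ^ n / of_nat n * (\<Sum>m<n. p m / a ^ m)"

text \<open>Only the outermost pair sees the index n as an exponent, so dividing by
  \<open>a ^ n\<close> replaces its root b by b / a. This handles the quotients in
  \<open>int1\<close>.\<close>

lemma lseq_twist: "\<exists>l'. (\<forall>(s, b)\<in>set l'. s \<ge> 1 \<and> b ^ 4 = 1) \<and> map fst l' = map fst l \<and>
    lseq l' = (\<lambda>n. lseq l n / a ^ n)"
  if "\<forall>(s, b)\<in>set l. s \<ge> 1 \<and> b ^ 4 = 1" "a ^ 4 = 1"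
proof (cases l)
  case Nil
  then show ?thesis by (intro exI[of _ "[]"]) auto
next
  case (Cons p l1)
  obtain s b where p: "p = (s, b)" by (cases p)
  show ?thesis using that Cons p
    by (intro exI[of _ "(s, b / a) # l1"]) (auto simp: power_divide)
qed

text \<open>Division by n raises the leading exponent by one; positive weight ensures that there is
  a leading pair.\<close>

lemma lspan_int0: "lspan W p \<Longrightarrow> W \<ge> 1 \<Longrightarrow> lspan (Suc W) (int0 p)"
proof (induction rule: lspan.induct)
  case (gen l)
  then obtain s a l1 where l: "l = (s, a) # l1" by (cases l) auto
  have "lspan (sum_list (map fst ((Suc s, a) # l1))) (lseq ((Suc s, a) # l1))"
    using gen l by (intro lspan.gen) auto
  moreover have "int0 (lseq l) = lseq ((Suc s, a) # l1)"
    by (auto simp: int0_def l field_simps)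
  ultimately show ?case by (simp add: l del: lseq.simps)
next
  case (add W p q)
  then have "lspan (Suc W) (\<lambda>n. int0 p n + int0 q n)" by (intro lspan.add) auto
  moreover have "int0 (\<lambda>n. p n + q n) = (\<lambda>n. int0 p n + int0 q n)"
    by (auto simp: int0_def add_divide_distrib)
  ultimately show ?case by simp
next
  case (scale W p c)
  then have "lspan (Suc W) (\<lambda>n. of_real (of_rat c) * int0 p n)" by (intro lspan.scale) auto
  moreover have "int0 (\<lambda>n. of_real (of_rat c) * p n) = (\<lambda>n. of_real (of_rat c) * int0 p n)"
    by (auto simp: int0_def)
  ultimately show ?case by simp
qed

text \<open>Once the twist has absorbed \<open>a ^ m\<close>, the operator prepends the pair
  \<open>(1, a)\<close>.\<close>

lemma lspan_int1: "lspan W p \<Longrightarrow> a ^ 4 = 1 \<Longrightarrow> lspan (Suc W) (int1 a p)"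
proof (induction rule: lspan.induct)
  case (gen l)
  from lseq_twist[OF gen] obtain l' where
    l': "\<forall>(s, b)\<in>set l'. s \<ge> 1 \<and> b ^ 4 = 1" "map fst l' = map fst l"
      "lseq l' = (\<lambda>n. lseq l n / a ^ n)"
    by blast
  have "lspan (sum_list (map fst ((1, a) # l'))) (lseq ((1, a) # l'))"
    using gen l' by (intro lspan.gen) auto
  moreover have "int1 a (lseq l) = lseq ((1, a) # l')"
    by (auto simp: int1_def l')
  ultimately show ?case by (simp add: l' del: lseq.simps)
next
  case (add W p q)
  then have "lspan (Suc W) (\<lambda>n. int1 a p n + int1 a q n)" by (intro lspan.add) auto
  moreover have "int1 a (\<lambda>n. p n + q n) = (\<lambda>n. int1 a p n + int1 a q n)"
    by (auto simp: int1_def add_divide_distrib sum.distrib distrib_left)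
  ultimately show ?case by simp
next
  case (scale W p c)
  then have "lspan (Suc W) (\<lambda>n. of_real (of_rat c) * int1 a p n)" by (intro lspan.scale) auto
  moreover have "int1 a (\<lambda>n. of_real (of_rat c) * p n) = (\<lambda>n. of_real (of_rat c) * int1 a p n)"
    by (simp add: int1_def fun_eq_iff mult.left_commute flip: sum_distrib_left times_divide_eq_right)
  ultimately show ?case by simp
qed

lemma lspan_scale_int:
  "lspan W p \<Longrightarrow> lspan W (\<lambda>n. of_int k * p n)"
  using lspan.scale[of W p "of_int k"] by simp

lemma summable_int0: "lspan W p \<Longrightarrow> summable (\<lambda>n. norm (int0 p n))"
  unfolding int0_def by (intro slow_imp_summable_div lspan_slow)

text \<open>On a generator, \<open>int0\<close> produces leading exponent at least 2, so the series
  converges absolutely and is the value of an admissible polylogarithm.\<close>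

lemma suminf_int0_in_CMZV: "lspan W p \<Longrightarrow> W \<ge> 1 \<Longrightarrow> (\<Sum>n. int0 p n) \<in> CMZV 4 (Suc W)"
proof (induction rule: lspan.induct)
  case (gen l)
  then obtain s a l1 where l: "l = (s, a) # l1" by (cases l) auto
  let ?l = "(Suc s, a) # l1"
  have eq: "int0 (lseq l) = lseq ?l"
    by (auto simp: int0_def l field_simps)
  have "summable (lseq ?l)"
    using summable_norm_cancel[OF summable_int0[OF lspan.gen[OF gen(1)]]] by (simp only: eq)
  then have "(\<lambda>N. \<Sum>n\<le>N. lseq ?l n) \<longlonglongrightarrow> suminf (lseq ?l)" by (rule summable_LIMSEQ')
  then have "Lpoly (map fst ?l) (map snd ?l) = suminf (lseq ?l)"
    unfolding Lpoly_def Ltrunc_eq_sum_lseq by (rule limI)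
  moreover have "Lpoly (map fst ?l) (map snd ?l) \<in> cmzv_gens 4 (Suc (sum_list (map fst l)))"
    unfolding cmzv_gens_def
    by (intro CollectI exI[of _ "map fst ?l"] exI[of _ "map snd ?l"]) (use gen l in auto)
  ultimately show ?case using CMZV_gen by (simp only: eq)
next
  case (add W p q)
  have "(\<Sum>n. int0 (\<lambda>n. p n + q n) n) = (\<Sum>n. int0 p n) + (\<Sum>n. int0 q n)"
    using suminf_add[OF summable_norm_cancel[OF summable_int0[OF add(1)]]
        summable_norm_cancel[OF summable_int0[OF add(2)]]]
    by (simp add: int0_def add_divide_distrib)
  with add show ?case by (simp add: CMZV_add)
next
  case (scale W p c)
  have "(\<Sum>n. int0 (\<lambda>n. of_real (of_rat c) * p n) n) = of_real (of_rat c) * (\<Sum>n. int0 p n)"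
    using suminf_mult[OF summable_norm_cancel[OF summable_int0[OF scale(1)]], of "of_real (of_rat c)"]
    by (simp add: int0_def)
  with scale show ?case by (simp add: CMZV_scale)
qed

section \<open>Power series\<close>

definition pser :: "(nat \<Rightarrow> 'a) \<Rightarrow> 'a \<Rightarrow> 'a::{real_normed_field, banach}" where
  "pser a z = (\<Sum>n. a n * z ^ n)"

lemma summable_bounded_pser:
  fixes a :: "nat \<Rightarrow> 'a::{real_normed_field, banach}"
  assumes "\<And>n. norm (a n) \<le> C" "norm z < 1"
  shows "summable (\<lambda>n. a n * z ^ n)"
proof (rule summable_comparison_test)
  show "summable (\<lambda>n. C * norm z ^ n)" using assms by (intro summable_mult summable_geometric) auto
  show "\<exists>N. \<forall>n\<ge>N. norm (a n * z ^ n) \<le> C * norm z ^ n"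
    using assms by (auto simp: norm_mult norm_power intro!: mult_right_mono)
qed

lemma slow_bounded: "slow a \<Longrightarrow> \<exists>C. \<forall>n. norm (a n) \<le> C"
proof -
  assume "slow a"
  then obtain C where C: "\<And>n. norm (a n) \<le> C / sqrt (Suc n)" by (auto simp: slow_def)
  have C0: "C \<ge> 0" using order_trans[OF norm_ge_zero C[of 0]] by simp
  have "C / sqrt (Suc n) \<le> C / 1" for n using C0 by (intro divide_left_mono) auto
  with C show ?thesis by (metis div_by_1 order_trans)
qed

lemma pser_sums:
  fixes a :: "nat \<Rightarrow> 'a::{real_normed_field, banach}"
  assumes "\<And>n. norm (a n) \<le> C" "norm z < 1"
  shows "(\<lambda>n. a n * z ^ n) sums pser a z"
  unfolding pser_def using summable_bounded_pser[OF assms] by (rule summable_sums)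

lemma pser_0: "pser a 0 = a 0"
  unfolding pser_def by (rule powser_zero)

text \<open>The Euler operator z d/dz multiplies the n-th coefficient by n without shifting indices,
  so recursions between coefficients become differential equations directly.\<close>

lemma pser_theta:
  fixes a :: "nat \<Rightarrow> 'a::{real_normed_field, banach}"
  assumes "\<And>n. norm (a n) \<le> C" "norm z < 1"
  obtains d where "(pser a has_field_derivative d) (at z)" "(\<lambda>n. of_nat n * a n * z ^ n) sums (z * d)"
proof
  let ?d = "\<Sum>n. diffs a n * z ^ n"
  show "(pser a has_field_derivative ?d) (at z)"
    unfolding pser_def[abs_def] using summable_bounded_pser[OF assms(1)] assms(2)
    by (rule termdiffs_strong')
  have "summable (\<lambda>n. diffs a n * z ^ n)"
    using assms(2) summable_bounded_pser[OF assms(1)] by (rule termdiff_converges)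
  then have "(\<lambda>n. z * (diffs a n * z ^ n)) sums (z * ?d)"
    by (intro sums_mult summable_sums)
  then have "(\<lambda>n. of_nat (Suc n) * a (Suc n) * z ^ Suc n) sums (z * ?d)"
    by (simp add: diffs_def mult_ac)
  then show "(\<lambda>n. of_nat n * a n * z ^ n) sums (z * ?d)"
    by (subst (asm) sums_Suc_iff) simp
qed

text \<open>The numbers v n = n * \<open>int1 a p n\<close> satisfy v (n + 1) = a v n + a p n. With
  F and P the two power series this reads z F' = a z (z F' + P), which is solved for F'.\<close>

lemma int1_deriv:
  assumes p: "slow p" and q: "slow (int1 a p)" and a: "norm a = 1" and z: "norm z < 1" "z \<noteq> 0"
  shows "(pser (int1 a p) has_field_derivative a / (1 - a * z) * pser p z) (at z)"
proof -
  obtain C where C: "\<And>n. norm (p n) \<le> C" using slow_bounded[OF p] by blast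
  obtain D where D: "\<And>n. norm (int1 a p n) \<le> D" using slow_bounded[OF q] by blast
  obtain d where d: "(pser (int1 a p) has_field_derivative d) (at z)"
    "(\<lambda>n. of_nat n * int1 a p n * z ^ n) sums (z * d)"
    by (rule pser_theta[OF D z(1)])
  have a0: "a \<noteq> 0" using a by auto
  define v where "v n = of_nat n * int1 a p n" for n
  have v: "v n = a ^ n * (\<Sum>m<n. p m / a ^ m)" for n
    by (cases "n = 0") (auto simp: v_def int1_def)
  have vS: "v (Suc n) * z ^ Suc n = a * z * (v n * z ^ n) + a * z * (p n * z ^ n)" for n
  proof -
    have "v (Suc n) = a * v n + a * p n" using a0 by (simp add: v algebra_simps)
    then show ?thesis by (simp add: algebra_simps)
  qed
  have "(\<lambda>n. v (Suc n) * z ^ Suc n) sums (a * z * (z * d) + a * z * pser p z)"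
    unfolding vS using d(2) pser_sums[OF C z(1)] unfolding v_def by (intro sums_add sums_mult)
  moreover have "(\<lambda>n. v (Suc n) * z ^ Suc n) sums (z * d)"
    using d(2) unfolding v_def[symmetric] by (subst sums_Suc_iff) (simp add: v)
  ultimately have "z * d = a * z * (z * d) + a * z * pser p z"
    by (metis sums_unique2)
  then have "z * (d * (1 - a * z)) = z * (a * pser p z)" by algebra
  then have "d * (1 - a * z) = a * pser p z" using z(2) mult_cancel_left by blast
  moreover have "a * z \<noteq> 1" using a z by (metis mult_1 norm_mult norm_one less_irrefl)
  ultimately have "d = a / (1 - a * z) * pser p z" by (simp add: field_simps)
  with d show ?thesis by simp
qed

text \<open>Multiplication by n undoes the division by n except at n = 0, where
  \<open>int0 p\<close> is 0 by the convention for division; there \<open>p 0 = 0\<close> is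
  used.\<close>

lemma int0_deriv:
  assumes p: "slow p" "p 0 = 0" and q: "slow (int0 p)" and z: "norm z < 1" "z \<noteq> 0"
  shows "(pser (int0 p) has_field_derivative pser p z / z) (at z)"
proof -
  obtain C where C: "\<And>n. norm (p n) \<le> C" using slow_bounded[OF p(1)] by blast
  obtain D where D: "\<And>n. norm (int0 p n) \<le> D" using slow_bounded[OF q] by blast
  obtain d where d: "(pser (int0 p) has_field_derivative d) (at z)"
    "(\<lambda>n. of_nat n * int0 p n * z ^ n) sums (z * d)"
    by (rule pser_theta[OF D z(1)])
  have "of_nat n * int0 p n = p n" for n using p by (cases "n = 0") (auto simp: int0_def)
  then have "(\<lambda>n. p n * z ^ n) sums (z * d)" using d(2) by (simp only:)
  then have "z * d = pser p z" using pser_sums[OF C z(1)] by (rule sums_unique2)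
  with z have "d = pser p z / z" by (simp add: field_simps)
  with d show ?thesis by simp
qed

lemma pser_deriv_add:
  assumes "slow p" "slow q" "norm z < 1"
    "(pser p has_field_derivative d) (at z)" "(pser q has_field_derivative e) (at z)"
  shows "(pser (\<lambda>n. p n + q n) has_field_derivative d + e) (at z)"
proof -
  obtain C D where C: "\<And>n. norm (p n) \<le> C" and D: "\<And>n. norm (q n) \<le> D"
    using slow_bounded assms(1,2) by metis
  have eq: "pser p w + pser q w = pser (\<lambda>n. p n + q n) w" if "w \<in> ball 0 1" for w
  proof -
    have "(\<lambda>n. (p n + q n) * w ^ n) sums (pser p w + pser q w)"
      unfolding distrib_right using that by (intro sums_add pser_sums[OF C] pser_sums[OF D]) auto
    then show ?thesis unfolding pser_def[of "\<lambda>n. p n + q n"] by (rule sums_unique)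
  qed
  show ?thesis
    by (rule has_field_derivative_transform_within_open[OF DERIV_add[OF assms(4,5)], of "ball 0 1"])
      (use assms(3) eq in auto)
qed

lemma pser_deriv_cmult:
  assumes "slow p" "norm z < 1" "(pser p has_field_derivative d) (at z)"
  shows "(pser (\<lambda>n. c * p n) has_field_derivative c * d) (at z)"
proof -
  obtain C where C: "\<And>n. norm (p n) \<le> C" using slow_bounded assms(1) by metis
  have eq: "c * pser p w = pser (\<lambda>n. c * p n) w" if "w \<in> ball 0 1" for w
  proof -
    have "(\<lambda>n. c * (p n * w ^ n)) sums (c * pser p w)"
      using that by (intro sums_mult pser_sums[OF C]) auto
    then show ?thesis unfolding pser_def[of "\<lambda>n. c * p n"] mult.assoc by (rule sums_unique)
  qed
  show ?thesis
    by (rule has_field_derivative_transform_within_open[OF DERIV_cmult[OF assms(3)], of "ball 0 1"])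
      (use assms(2) eq in auto)
qed

lemma slow_isCont_pser:
  assumes "slow p" "norm z < 1"
  shows "isCont (pser p) z"
proof -
  obtain C where C: "\<And>n. norm (p n) \<le> C" using slow_bounded assms(1) by metis
  obtain d where "(pser p has_field_derivative d) (at z)" by (rule pser_theta[OF C assms(2)])
  then show ?thesis by (rule DERIV_isCont)
qed

text \<open>Uniqueness of antiderivatives, the common tool for identifying a real function with a
  power series. Derivatives are compared on the open interval only, because some integrands divide
  by t; the endpoint 0 is reached by continuity. The constant \<open>k\<close> is 1 or
  \<open>\<i>\<close> in the applications.\<close>

lemma eq_pser_if_deriv_eq:
  fixes F F' :: "real \<Rightarrow> real" and P' :: "real \<Rightarrow> complex"
  assumes p: "slow p" and F: "continuous_on {0..<1} F"
    and dF: "\<And>t. 0 < t \<Longrightarrow> t < 1 \<Longrightarrow> (F has_real_derivative F' t) (at t)"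
    and dp: "\<And>t. 0 < t \<Longrightarrow> t < 1 \<Longrightarrow> (pser p has_field_derivative P' t) (at (of_real t))"
    and eq: "\<And>t. 0 < t \<Longrightarrow> t < 1 \<Longrightarrow> of_real (F' t) = k * P' t"
    and eq0: "of_real (F 0) = k * p 0" and t: "0 \<le> t" "t < 1"
  shows "of_real (F t) = k * pser p (of_real t)"
proof -
  define G where "G = (\<lambda>t. of_real (F t) - k * pser p (of_real t))"
  have cp: "continuous_on {0..t} (\<lambda>t. pser p (of_real t))"
  proof (rule continuous_at_imp_continuous_on, intro ballI)
    fix u assume u: "u \<in> {0..t}"
    have "isCont (pser p) (of_real u)" using u t by (intro slow_isCont_pser[OF p]) auto
    then show "isCont (\<lambda>t. pser p (of_real t)) u"
      by (rule isCont_o2[rotated]) simp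
  qed
  have cont: "continuous_on {0..t} G"
    unfolding G_def using cp t
    by (intro continuous_intros continuous_on_subset[OF F]) auto
  have "(G has_vector_derivative 0) (at u)" if u: "u \<in> {0<..<t}" for u
  proof -
    have "((\<lambda>t. pser p (of_real t)) has_vector_derivative P' u) (at u)"
      using u t by (intro has_vector_derivative_real_field dp) auto
    moreover have "((\<lambda>t. complex_of_real (F t)) has_vector_derivative of_real (F' u)) (at u)"
      using u t by (intro has_vector_derivative_of_real dF) auto
    ultimately have "(G has_vector_derivative (of_real (F' u) - k * P' u)) (at u)"
      unfolding G_def by (intro has_vector_derivative_diff has_vector_derivative_mult_right)
    then show ?thesis using eq u t by simp
  qed
  then have "((\<lambda>_. 0) has_integral (G t - G 0)) {0..t}"
    using t cont by (intro fundamental_theorem_of_calculus_interior) auto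
  then have "G t = G 0"
    by (metis has_integral_0_eq right_minus_eq)
  also have "G 0 = 0" using eq0 by (simp add: G_def pser_0)
  finally show ?thesis by (simp add: G_def)
qed

text \<open>With \<open>z = tan (\<theta>/2)\<close> these are integration against \<open>\<i> d\<theta>\<close>, \<open>cot \<theta> d\<theta>\<close> and
  \<open>tan \<theta> d\<theta>\<close>; the factor \<open>\<i>\<close> in the first one keeps the coefficients rational.\<close>

definition int_theta :: "(nat \<Rightarrow> complex) \<Rightarrow> nat \<Rightarrow> complex" where
  "int_theta p = (\<lambda>n. int1 \<i> p n + of_int (-1) * int1 (-\<i>) p n)"

definition int_cot :: "(nat \<Rightarrow> complex) \<Rightarrow> nat \<Rightarrow> complex" where
  "int_cot p = (\<lambda>n. int0 p n + (int1 \<i> p n + int1 (-\<i>) p n))"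

definition int_tan :: "(nat \<Rightarrow> complex) \<Rightarrow> nat \<Rightarrow> complex" where
  "int_tan p = (\<lambda>n. (int1 1 p n + int1 (-1) p n) + of_int (-1) * (int1 \<i> p n + int1 (-\<i>) p n))"

lemma lspan_int_theta: "lspan W p \<Longrightarrow> lspan (Suc W) (int_theta p)"
  unfolding int_theta_def by (intro lspan.add lspan_scale_int lspan_int1) auto

lemma lspan_int_cot: "lspan W p \<Longrightarrow> W \<ge> 1 \<Longrightarrow> lspan (Suc W) (int_cot p)"
  unfolding int_cot_def by (intro lspan.add lspan_int0 lspan_int1) auto

lemma lspan_int_tan: "lspan W p \<Longrightarrow> lspan (Suc W) (int_tan p)"
  unfolding int_tan_def by (intro lspan.add lspan_scale_int lspan_int1) auto

section \<open>Derivatives of the trigonometric integration operators\<close>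

lemma one_plus_square_neq_0: "norm z < 1 \<Longrightarrow> 1 + z ^ 2 \<noteq> (0::complex)"
proof
  assume z: "norm z < 1" "1 + z ^ 2 = 0"
  then have "norm (z ^ 2) = 1" by (metis add_eq_0_iff norm_minus_cancel norm_one)
  moreover have "norm z ^ 2 < 1" using z by (simp add: power_less_one_iff)
  ultimately show False by (simp add: norm_power)
qed

lemma one_minus_square_neq_0: "norm z < 1 \<Longrightarrow> 1 - z ^ 2 \<noteq> (0::complex)"
proof
  assume z: "norm z < 1" "1 - z ^ 2 = 0"
  then have "norm (z ^ 2) = 1" by simp
  moreover have "norm z ^ 2 < 1" using z by (simp add: power_less_one_iff)
  ultimately show False by (simp add: norm_power)
qed

lemma lspan_int1_deriv:
  assumes "lspan W p" "a ^ 4 = 1" "norm z < 1" "z \<noteq> 0"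
  shows "(pser (int1 a p) has_field_derivative a / (1 - a * z) * pser p z) (at z)"
  using assms by (intro int1_deriv lspan_slow[OF assms(1)] lspan_slow[OF lspan_int1[OF assms(1)]]
      norm_eq_1_of_power4)

lemma lspan_int0_deriv:
  assumes "lspan W p" "W \<ge> 1" "norm z < 1" "z \<noteq> 0"
  shows "(pser (int0 p) has_field_derivative pser p z / z) (at z)"
  using assms by (intro int0_deriv lspan_slow[OF assms(1)] lspan_slow[OF lspan_int0[OF assms(1)]]
      lspan_at_0[OF assms(1)])

lemma i_power4 [simp]: "\<i> ^ 4 = 1" "(-\<i>) ^ 4 = 1"
  by (simp_all add: power4_eq_xxxx)

lemma linear_factors_neq_0:
  assumes "norm z < 1"
  shows "1 - z \<noteq> (0::complex)" "1 + z \<noteq> 0" "1 - \<i> * z \<noteq> 0" "1 + \<i> * z \<noteq> 0"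
proof -
  have "(1 - z) * (1 + z) \<noteq> 0" "(1 - \<i> * z) * (1 + \<i> * z) \<noteq> 0"
    using one_plus_square_neq_0[OF assms] one_minus_square_neq_0[OF assms]
    by (simp_all add: algebra_simps power2_eq_square)
  then show "1 - z \<noteq> (0::complex)" "1 + z \<noteq> 0" "1 - \<i> * z \<noteq> 0" "1 + \<i> * z \<noteq> 0" by auto
qed

text \<open>Partial fractions of d\<theta> = 2 dz / (1 + z^2) over the factors 1 -
  \<open>\<i>\<close> z and 1 + \<open>\<i>\<close> z.\<close>

lemma int_theta_deriv:
  assumes p: "lspan W p" and z: "norm z < 1" "z \<noteq> 0"
  shows "(pser (int_theta p) has_field_derivative \<i> * (2 / (1 + z ^ 2)) * pser p z) (at z)"
proof -
  have "(pser (int_theta p) has_field_derivative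
      \<i> / (1 - \<i> * z) * pser p z + of_int (-1) * ((-\<i>) / (1 - (-\<i>) * z) * pser p z)) (at z)"
    unfolding int_theta_def
    by (intro pser_deriv_add pser_deriv_cmult lspan_int1_deriv[OF p] z slow_cmult
        lspan_slow[OF lspan_int1[OF p]]) auto
  also have "\<i> / (1 - \<i> * z) * pser p z + of_int (-1) * ((-\<i>) / (1 - (-\<i>) * z) * pser p z) =
      (\<i> / (1 - \<i> * z) + \<i> / (1 + \<i> * z)) * pser p z"
    by (simp add: algebra_simps)
  also have "\<i> / (1 - \<i> * z) + \<i> / (1 + \<i> * z) = \<i> * (2 / (1 + z ^ 2))"
  proof -
    have "1 + z ^ 2 = (1 - \<i> * z) * (1 + \<i> * z)" by (simp add: algebra_simps power2_eq_square)
    then show ?thesis using linear_factors_neq_0[OF z(1)] by (simp add: divide_simps) (simp add: algebra_simps)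
  qed
  finally show ?thesis .
qed

lemma int1_i_sum:
  assumes z: "norm z < 1"
  shows "\<i> / (1 - \<i> * z) + (-\<i>) / (1 - (-\<i>) * z) = - (2 * z / (1 + z ^ 2))"
proof -
  have "1 + z ^ 2 = (1 - \<i> * z) * (1 + \<i> * z)" by (simp add: algebra_simps power2_eq_square)
  then show ?thesis using linear_factors_neq_0[OF z] by (simp add: divide_simps) (simp add: algebra_simps)
qed

lemma int1_1_sum:
  assumes z: "norm z < 1"
  shows "1 / (1 - 1 * z) + (-1) / (1 - (-1) * z) = 2 * z / (1 - z ^ 2 :: complex)"
proof -
  have "1 - z ^ 2 = (1 - z) * (1 + z)" by (simp add: algebra_simps power2_eq_square)
  then show ?thesis using linear_factors_neq_0[OF z] by (simp add: divide_simps)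
qed

text \<open>Here cot \<theta> d\<theta> = (1/z - 2z / (1 + z^2)) dz; the second term is the sum of
  the two forms for \<open>\<i>\<close> and \<open>-\<i>\<close>.\<close>

lemma int_cot_deriv:
  assumes p: "lspan W p" "W \<ge> 1" and z: "norm z < 1" "z \<noteq> 0"
  shows "(pser (int_cot p) has_field_derivative (1 - z ^ 2) / (z * (1 + z ^ 2)) * pser p z) (at z)"
proof -
  have "(pser (int_cot p) has_field_derivative
      pser p z / z + (\<i> / (1 - \<i> * z) * pser p z + (-\<i>) / (1 - (-\<i>) * z) * pser p z)) (at z)"
    unfolding int_cot_def
    by (intro pser_deriv_add lspan_int0_deriv[OF p] lspan_int1_deriv[OF p(1)] z slow_add
        lspan_slow[OF lspan_int0[OF p]] lspan_slow[OF lspan_int1[OF p(1)]]) auto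
  also have "pser p z / z + (\<i> / (1 - \<i> * z) * pser p z + (-\<i>) / (1 - (-\<i>) * z) * pser p z) =
     (1 / z + - (2 * z / (1 + z ^ 2))) * pser p z"
    unfolding distrib_right[symmetric] int1_i_sum[OF z(1)] by (simp add: algebra_simps)
  also have "1 / z + - (2 * z / (1 + z ^ 2)) = (1 - z ^ 2) / (z * (1 + z ^ 2))"
    using z one_plus_square_neq_0[OF z(1)] by (simp add: field_simps power2_eq_square)
  finally show ?thesis .
qed

text \<open>Here tan \<theta> d\<theta> = (2z / (1 - z^2) + 2z / (1 + z^2)) dz, where the first term
  comes from the roots 1 and -1 and the second from \<open>\<i>\<close> and
  \<open>-\<i>\<close>.\<close>

lemma int_tan_deriv:
  assumes p: "lspan W p" and z: "norm z < 1" "z \<noteq> 0"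
  shows "(pser (int_tan p) has_field_derivative 4 * z / ((1 - z ^ 2) * (1 + z ^ 2)) * pser p z) (at z)"
proof -
  have "(pser (int_tan p) has_field_derivative
      (1 / (1 - 1 * z) * pser p z + (-1) / (1 - (-1) * z) * pser p z) +
       of_int (-1) * (\<i> / (1 - \<i> * z) * pser p z + (-\<i>) / (1 - (-\<i>) * z) * pser p z)) (at z)"
    unfolding int_tan_def
    by (intro pser_deriv_add pser_deriv_cmult lspan_int1_deriv[OF p] z slow_add slow_cmult
        lspan_slow[OF lspan_int1[OF p]]) auto
  also have "(1 / (1 - 1 * z) * pser p z + (-1) / (1 - (-1) * z) * pser p z) +
       of_int (-1) * (\<i> / (1 - \<i> * z) * pser p z + (-\<i>) / (1 - (-\<i>) * z) * pser p z) =
     (2 * z / (1 - z ^ 2) + 2 * z / (1 + z ^ 2)) * pser p z"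
    unfolding distrib_right[symmetric] int1_i_sum[OF z(1)] int1_1_sum[OF z(1)] by (simp add: algebra_simps)
  also have "2 * z / (1 - z ^ 2) + 2 * z / (1 + z ^ 2) = 4 * z / ((1 - z ^ 2) * (1 + z ^ 2))"
    using one_minus_square_neq_0[OF z(1)] one_plus_square_neq_0[OF z(1)]
    by (simp add: divide_simps) (simp add: algebra_simps)
  finally show ?thesis .
qed

section \<open>Generating functions with one central binomial coefficient\<close>

definition bc :: "nat \<Rightarrow> real" where
  "bc n = 4 ^ n / real (2 * n choose n)"

lemma bc_0: "bc 0 = 1"
  by (simp add: bc_def)

lemma bc_Suc: "bc (Suc n) = (2 * real n + 2) / (2 * real n + 1) * bc n"
proof -
  have bc: "bc n = 4 ^ n * (fact n * fact n) / fact (2 * n)" for n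
    unfolding bc_def by (subst binomial_fact) (auto simp: mult_2)
  \<comment> \<open>Powers and factorials are abstracted to real variables, with x = n + 1, leaving
    a pure field identity.\<close>
  have cancel: "4 * E * (x * F * (x * F)) / (2 * x * (2 * x - 1) * G) =
      2 * x / (2 * x - 1) * (E * (F * F) / G)" if "x > 0" "2 * x - 1 > 0" "G \<noteq> 0"
    for E F G x :: real
    using that by (simp add: divide_simps)
  have "fact (2 * Suc n) = 2 * (real n + 1) * (2 * (real n + 1) - 1) * fact (2 * n)"
    by (simp add: algebra_simps)
  then have "bc (Suc n) = 4 * 4 ^ n * ((real n + 1) * fact n * ((real n + 1) * fact n)) /
      (2 * (real n + 1) * (2 * (real n + 1) - 1) * fact (2 * n))"
    unfolding bc[of "Suc n"] by (simp only: fact_Suc power_Suc) (simp add: add.commute)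
  also have "\<dots> = 2 * (real n + 1) / (2 * (real n + 1) - 1) * bc n"
    unfolding bc[of n] by (rule cancel) auto
  finally show ?thesis by (simp add: algebra_simps)
qed

lemma bc_pos: "bc n > 0"
  unfolding bc_def by simp

text \<open>The bound is chosen so that the induction closes: after clearing denominators the two
  sides of the step differ by exactly 1.\<close>

lemma bc_square_le: "bc n ^ 2 \<le> 4 * n + 1"
proof (induction n)
  case (Suc n)
  have "bc (Suc n) ^ 2 = (2 * real n + 2) ^ 2 / (2 * real n + 1) ^ 2 * bc n ^ 2"
    by (simp add: bc_Suc power_divide power_mult_distrib)
  also have "\<dots> \<le> (2 * real n + 2) ^ 2 / (2 * real n + 1) ^ 2 * (4 * n + 1)"
    using Suc by (intro mult_left_mono) auto
  also have "\<dots> \<le> 4 * Suc n + 1"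
  proof -
    have "(2 * real n + 2) ^ 2 * (4 * n + 1) \<le> (4 * Suc n + 1) * (2 * real n + 1) ^ 2"
      by (simp add: algebra_simps power2_eq_square)
    moreover have "(2 * real n + 1) ^ 2 > 0" by simp
    ultimately show ?thesis by (simp only: times_divide_eq_left pos_divide_le_eq)
  qed
  finally show ?case by simp
qed (simp add: bc_0)

lemma bc_le: "bc n \<le> 2 * sqrt (Suc n)"
proof -
  have "bc n ^ 2 \<le> (2 * sqrt (Suc n)) ^ 2"
    using bc_square_le[of n] by (simp add: power_mult_distrib)
  then show ?thesis by (rule power2_le_imp_le) simp
qed

text \<open>For \<open>ts = word_comp w\<close>, \<open>hf (s # ts)\<close> is the function f(s,w)
  of the overview.\<close>

definition hf :: "nat list \<Rightarrow> real \<Rightarrow> real" where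
  "hf ts = pser (\<lambda>n. hseq ts n * bc n)"

text \<open>This is \<open>hf (1 # ts) y\<close> divided by y, given as a power series so that it is
  also differentiable at y = 0.\<close>

definition hq :: "nat list \<Rightarrow> real \<Rightarrow> real" where
  "hq ts = pser (\<lambda>n. (\<Sum>m\<le>n. hseq ts m) * bc (Suc n) / Suc n)"

text \<open>The decay 1 / sqrt n of \<open>hseq\<close> exactly compensates the growth sqrt n of
  \<open>bc\<close>.\<close>

lemma hf_coeff_bounded:
  assumes "\<forall>t\<in>set ts. t \<ge> 1"
  obtains C where "\<And>n. norm (hseq ts n * bc n) \<le> C"
proof -
  obtain C where C: "\<And>n. norm (hseq ts n) \<le> C / sqrt (Suc n)"
    using slow_hseq[OF assms] by (auto simp: slow_def)
  have "norm (hseq ts n * bc n) \<le> 2 * C" for n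
  proof -
    have "norm (hseq ts n * bc n) \<le> (C / sqrt (Suc n)) * (2 * sqrt (Suc n))"
      unfolding norm_mult using C bc_le bc_pos[of n] order_trans[OF norm_ge_zero C[of n]]
      by (intro mult_mono) auto
    then show ?thesis by simp
  qed
  then show ?thesis by (rule that)
qed

lemma hq_coeff_bounded:
  assumes "\<forall>t\<in>set ts. t \<ge> 1"
  obtains C where "\<And>n. norm ((\<Sum>m\<le>n. hseq ts m) * bc (Suc n) / Suc n) \<le> C"
proof -
  have "\<forall>t\<in>set (1 # ts). t \<ge> 1" using assms by auto
  then obtain C where C: "\<And>n. norm (hseq (1 # ts) n * bc n) \<le> C" using hf_coeff_bounded by blast
  show ?thesis using C[of "Suc _"]
    by (intro that[of C]) (simp add: lessThan_Suc_atMost del: sum.lessThan_Suc)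
qed

lemma hf_Cons_1:
  assumes "\<forall>t\<in>set ts. t \<ge> 1" "\<bar>y\<bar> < 1"
  shows "hf (1 # ts) y = y * hq ts y"
proof -
  obtain C where C: "\<And>n. norm ((\<Sum>m\<le>n. hseq ts m) * bc (Suc n) / Suc n) \<le> C"
    using hq_coeff_bounded[OF assms(1)] by blast
  have "(\<lambda>n. y * (((\<Sum>m\<le>n. hseq ts m) * bc (Suc n) / Suc n) * y ^ n)) sums (y * hq ts y)"
    unfolding hq_def using assms by (intro sums_mult pser_sums[OF C]) auto
  then have "(\<lambda>n. (hseq (1 # ts) (Suc n) * bc (Suc n)) * y ^ Suc n) sums (y * hq ts y)"
    by (simp add: lessThan_Suc_atMost mult_ac del: sum.lessThan_Suc)
  then have "(\<lambda>n. (hseq (1 # ts) n * bc n) * y ^ n) sums (y * hq ts y)"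
    by (subst (asm) sums_Suc_iff) simp
  then show ?thesis unfolding hf_def pser_def by (simp add: sums_iff)
qed

lemma hf_deriv:
  assumes "\<forall>t\<in>set ts. t \<ge> 1" "s \<ge> 1" "\<bar>y\<bar> < 1"
  obtains d where "(hf (Suc s # ts) has_real_derivative d) (at y)" "y * d = hf (s # ts) y"
proof -
  have ts: "\<forall>t\<in>set (s # ts). t \<ge> 1" "\<forall>t\<in>set (Suc s # ts). t \<ge> 1" using assms by auto
  obtain C where C: "\<And>n. norm (hseq (Suc s # ts) n * bc n) \<le> C"
    using hf_coeff_bounded[OF ts(2)] by blast
  obtain D where D: "\<And>n. norm (hseq (s # ts) n * bc n) \<le> D"
    using hf_coeff_bounded[OF ts(1)] by blast
  have y: "norm y < 1" using assms by simp
  obtain d where d: "(hf (Suc s # ts) has_real_derivative d) (at y)"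
      "(\<lambda>n. of_nat n * (hseq (Suc s # ts) n * bc n) * y ^ n) sums (y * d)"
    unfolding hf_def by (rule pser_theta[OF C y])
  have "of_nat n * (hseq (Suc s # ts) n * bc n) = hseq (s # ts) n * bc n" for n
    using assms(2) by (cases "n = 0") auto
  then have "(\<lambda>n. hseq (s # ts) n * bc n * y ^ n) sums (y * d)" using d(2) by (simp only:)
  then have "y * d = hf (s # ts) y" unfolding hf_def using pser_sums[OF D y] by (rule sums_unique2)
  with d(1) show ?thesis by (rule that)
qed

text \<open>The coefficients q n of \<open>hq ts\<close> satisfy (n + 1/2) q n - n q (n - 1) =
  \<open>hseq ts n * bc n\<close>: by the recursion for \<open>bc\<close>, both products on the left
  are partial sums of \<open>hseq\<close> times \<open>bc n\<close>, and the sums differ by one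
  term.\<close>

lemma hq_deriv:
  assumes "\<forall>t\<in>set ts. t \<ge> 1" "\<bar>y\<bar> < 1"
  obtains d where "(hq ts has_real_derivative d) (at y)"
    "(1 - 2 * y) * hq ts y / 2 + (1 - y) * (y * d) = hf ts y"
proof -
  obtain C where C: "\<And>n. norm ((\<Sum>m\<le>n. hseq ts m) * bc (Suc n) / Suc n) \<le> C"
    using hq_coeff_bounded[OF assms(1)] by blast
  obtain D where D: "\<And>n. norm (hseq ts n * bc n) \<le> D"
    using hf_coeff_bounded[OF assms(1)] by blast
  have y: "norm y < 1" using assms by simp
  define q where "q n = (\<Sum>m\<le>n. hseq ts m) * bc (Suc n) / Suc n" for n
  obtain d where d: "(hq ts has_real_derivative d) (at y)"
      "(\<lambda>n. of_nat n * q n * y ^ n) sums (y * d)"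
    unfolding hq_def q_def by (rule pser_theta[OF C y])
  have q: "(\<lambda>n. q n * y ^ n) sums hq ts y"
    unfolding hq_def q_def using pser_sums[OF C y] .
  have f: "(\<lambda>n. hseq ts n * bc n * y ^ n) sums hf ts y"
    unfolding hf_def using pser_sums[OF D y] .
  have "(\<lambda>n. y * (real n * q n * y ^ n + q n * y ^ n)) sums (y * (y * d + hq ts y))"
    by (intro sums_mult sums_add d q)
  then have "(\<lambda>n. real (Suc n) * q (Suc n - 1) * y ^ Suc n) sums (y * (y * d + hq ts y))"
    by (simp add: algebra_simps)
  then have "(\<lambda>n. real n * q (n - 1) * y ^ n) sums (y * (y * d + hq ts y))"
    by (subst (asm) sums_Suc_iff[where f = "\<lambda>n. real n * q (n - 1) * y ^ n"]) simp
  then have "(\<lambda>n. (real n * q n * y ^ n + q n * y ^ n / 2) - real n * q (n - 1) * y ^ n) sums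
      ((y * d + hq ts y / 2) - y * (y * d + hq ts y))"
    by (intro sums_diff sums_add sums_divide d q)
  moreover have "(real n * q n * y ^ n + q n * y ^ n / 2) - real n * q (n - 1) * y ^ n =
      hseq ts n * bc n * y ^ n" for n
  proof -
    have 1: "(real n + 1 / 2) * q n = (\<Sum>m\<le>n. hseq ts m) * bc n"
    proof -
      have "(real n + 1 / 2) * (S * bc (Suc n) / Suc n) =
          S * ((2 * real n + 1) * bc (Suc n) / (2 * Suc n))" for S
        by (simp add: field_simps)
      moreover have "(2 * real n + 1) * bc (Suc n) / (2 * Suc n) = bc n"
        unfolding bc_Suc by (simp add: divide_simps)
      ultimately show ?thesis unfolding q_def by (simp only:)
    qed
    have 2: "real n * q (n - 1) = (\<Sum>m<n. hseq ts m) * bc n"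
      by (cases n) (auto simp: q_def lessThan_Suc_atMost simp del: sum.lessThan_Suc)
    have "(real n + 1 / 2) * q n - real n * q (n - 1) = hseq ts n * bc n"
      unfolding 1 2 by (simp add: algebra_simps flip: lessThan_Suc_atMost)
    then have "((real n + 1 / 2) * q n - real n * q (n - 1)) * y ^ n = hseq ts n * bc n * y ^ n" by simp
    then show ?thesis by (simp add: algebra_simps)
  qed
  ultimately have "(\<lambda>n. hseq ts n * bc n * y ^ n) sums
      ((y * d + hq ts y / 2) - y * (y * d + hq ts y))" by (simp only:)
  then have "(y * d + hq ts y / 2) - y * (y * d + hq ts y) = hf ts y" using f by (rule sums_unique2)
  then have "(1 - 2 * y) * hq ts y / 2 + (1 - y) * (y * d) = hf ts y" by (simp add: field_simps)
  with d(1) show ?thesis by (rule that)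
qed

text \<open>Sine and cosine of \<open>\<theta>\<close> in terms of \<open>t = tan (\<theta>/2)\<close>.\<close>

definition xx :: "real \<Rightarrow> real" where "xx t = 2 * t / (1 + t ^ 2)"

definition cc :: "real \<Rightarrow> real" where "cc t = (1 - t ^ 2) / (1 + t ^ 2)"

lemma one_plus_square_pos: "1 + t ^ 2 > (0::real)"
  by (simp add: add_pos_nonneg)

lemma cc_square: "cc t ^ 2 = 1 - xx t ^ 2"
proof -
  have "(1 - t ^ 2) ^ 2 = (1 + t ^ 2) ^ 2 - (2 * t) ^ 2" by algebra
  then show ?thesis using one_plus_square_pos[of t]
    unfolding cc_def xx_def power_divide by (simp add: divide_simps)
qed

lemma xx_deriv: "(xx has_real_derivative cc t * (2 / (1 + t ^ 2))) (at t)"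
  unfolding xx_def cc_def using one_plus_square_pos[of t]
  by (auto intro!: derivative_eq_intros simp: field_simps power2_eq_square)

lemma cc_deriv: "(cc has_real_derivative - xx t * (2 / (1 + t ^ 2))) (at t)"
  unfolding xx_def cc_def using one_plus_square_pos[of t]
  by (auto intro!: derivative_eq_intros simp: field_simps power2_eq_square)

text \<open>The second bound keeps the sine uniformly away from 1 when t stays below some r < 1,
  which yields a geometric majorant later.\<close>

lemma xx_bounds: "0 \<le> t \<Longrightarrow> xx t \<ge> 0" "xx t \<le> 1 - (1 - t) ^ 2 / (1 + t ^ 2)"
  "0 \<le> t \<Longrightarrow> t < 1 \<Longrightarrow> xx t ^ 2 < 1"
proof -
  show "0 \<le> t \<Longrightarrow> xx t \<ge> 0" by (simp add: xx_def)
  show "xx t \<le> 1 - (1 - t) ^ 2 / (1 + t ^ 2)"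
    using one_plus_square_pos[of t] by (simp add: xx_def field_simps power2_eq_square)
  assume "0 \<le> t" "t < 1"
  then have "cc t > 0" unfolding cc_def using one_plus_square_pos[of t]
    by (intro divide_pos_pos) (auto simp: power_less_one_iff)
  then have "cc t ^ 2 > 0" by simp
  then show "xx t ^ 2 < 1" using cc_square[of t] by simp
qed

lemma xx_square_deriv:
  "((\<lambda>t. xx t ^ 2) has_real_derivative 2 * xx t * (cc t * (2 / (1 + t ^ 2)))) (at t)"
  using xx_deriv[of t] by (auto intro!: derivative_eq_intros)

text \<open>With y = sin^2 \<theta> one has dy / y = 2 cot \<theta> d\<theta>, and y d/dy lowers the
  leading exponent.\<close>

lemma hf_xx_deriv:
  assumes "\<forall>t\<in>set ts. t \<ge> 1" "s \<ge> 1" "0 < t" "t < 1"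
  shows "((\<lambda>t. hf (Suc s # ts) (xx t ^ 2)) has_real_derivative
    2 * ((1 - t ^ 2) / (t * (1 + t ^ 2))) * hf (s # ts) (xx t ^ 2)) (at t)"
proof -
  have y: "\<bar>xx t ^ 2\<bar> < 1" using xx_bounds[of t] assms by simp
  obtain d where d: "(hf (Suc s # ts) has_real_derivative d) (at (xx t ^ 2))"
    "xx t ^ 2 * d = hf (s # ts) (xx t ^ 2)"
    by (rule hf_deriv[OF assms(1,2) y])
  have "((\<lambda>t. hf (Suc s # ts) (xx t ^ 2)) has_real_derivative
      d * (2 * xx t * (cc t * (2 / (1 + t ^ 2))))) (at t)"
    using DERIV_chain2[OF d(1) xx_square_deriv] .
  also have "d * (2 * xx t * (cc t * (2 / (1 + t ^ 2)))) =
      2 * ((1 - t ^ 2) / (t * (1 + t ^ 2))) * (xx t ^ 2 * d)"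
  proof -
    have "xx t * (cc t * (2 / (1 + t ^ 2))) = (1 - t ^ 2) / (t * (1 + t ^ 2)) * xx t ^ 2"
    proof -
      have "2 * t / D * (N / D * (2 / D)) = N / (t * D) * (2 * t / D) ^ 2" if "D > 0" for D N :: real
        using that assms(3) by (simp add: divide_simps power2_eq_square)
      then show ?thesis unfolding xx_def cc_def using one_plus_square_pos[of t] by blast
    qed
    then show ?thesis by algebra
  qed
  finally show ?thesis by (simp only: d(2))
qed

lemma hf_xx_cont:
  assumes "\<forall>t\<in>set ts. t \<ge> 1" "s \<ge> 1"
  shows "continuous_on {0..<1} (\<lambda>t. hf (Suc s # ts) (xx t ^ 2))"
proof (rule continuous_at_imp_continuous_on, intro ballI)
  fix t :: real assume "t \<in> {0..<1}"
  then have y: "\<bar>xx t ^ 2\<bar> < 1" using xx_bounds[of t] by simp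
  obtain d where d: "(hf (Suc s # ts) has_real_derivative d) (at (xx t ^ 2))"
    by (rule hf_deriv[OF assms y])
  show "isCont (\<lambda>t. hf (Suc s # ts) (xx t ^ 2)) t"
    using DERIV_chain2[OF d xx_square_deriv] by (rule DERIV_isCont)
qed

text \<open>This is the integral of \<open>hf ts (sin\<^sup>2 \<theta>) d\<theta>\<close>, written without an integral sign.\<close>

definition hE :: "nat list \<Rightarrow> real \<Rightarrow> real" where
  "hE ts t = cc t * xx t * hq ts (xx t ^ 2) / 2"

text \<open>The product rule leaves the left side of the differential equation in
  \<open>hq_deriv\<close> at y = sin^2 \<theta>, since cos^2 \<theta> = 1 - y.\<close>

lemma hE_deriv:
  assumes "\<forall>t\<in>set ts. t \<ge> 1" "0 \<le> t" "t < 1"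
  shows "(hE ts has_real_derivative 2 / (1 + t ^ 2) * hf ts (xx t ^ 2)) (at t)"
proof -
  have y: "\<bar>xx t ^ 2\<bar> < 1" using xx_bounds[of t] assms by simp
  obtain d where d: "(hq ts has_real_derivative d) (at (xx t ^ 2))"
    "(1 - 2 * xx t ^ 2) * hq ts (xx t ^ 2) / 2 + (1 - xx t ^ 2) * (xx t ^ 2 * d) = hf ts (xx t ^ 2)"
    by (rule hq_deriv[OF assms(1) y])
  let ?w = "2 / (1 + t ^ 2)"
  let ?Q = "hq ts (xx t ^ 2)"
  have "(hE ts has_real_derivative
     (cc t * xx t * (d * (2 * xx t * (cc t * ?w))) +
      (cc t * (cc t * ?w) + - xx t * ?w * xx t) * ?Q) / 2) (at t)"
    unfolding hE_def
    by (rule DERIV_cong[OF DERIV_cdivide[OF DERIV_mult[OF DERIV_mult[OF cc_deriv xx_deriv] DERIV_chain2[OF d(1) xx_square_deriv]]]])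
      (simp add: algebra_simps)
  also have "(cc t * xx t * (d * (2 * xx t * (cc t * ?w))) +
      (cc t * (cc t * ?w) + - xx t * ?w * xx t) * ?Q) / 2 =
      ?w * ((cc t ^ 2 - xx t ^ 2) * ?Q / 2 + cc t ^ 2 * (xx t ^ 2 * d))"
  proof -
    have "(c * x * (d * (2 * x * (c * w))) + (c * (c * w) + - x * w * x) * Q) / 2 =
      w * ((c ^ 2 - x ^ 2) * Q / 2 + c ^ 2 * (x ^ 2 * d))" for c x w Q :: real
      by (simp add: field_simps power2_eq_square)
    then show ?thesis .
  qed
  also have "\<dots> = ?w * hf ts (xx t ^ 2)"
    unfolding d(2)[symmetric] cc_square by simp
  finally show ?thesis .
qed

lemma hE_cont: "\<forall>t\<in>set ts. t \<ge> 1 \<Longrightarrow> continuous_on {0..<1} (hE ts)"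
  by (intro continuous_at_imp_continuous_on ballI DERIV_isCont[OF hE_deriv]) auto

lemma hE_0: "hE ts 0 = 0"
  by (simp add: hE_def xx_def)

lemma hf_1_eq_hE:
  assumes "\<forall>t\<in>set ts. t \<ge> 1" "0 \<le> t" "t < 1"
  shows "cc t * hf (1 # ts) (xx t ^ 2) = 2 * xx t * hE ts t"
  using hf_Cons_1[OF assms(1), of "xx t ^ 2"] xx_bounds(3)[OF assms(2,3)]
  by (simp add: hE_def power2_eq_square)

lemma hf_xx_0: "hf (s # ts) (xx 0 ^ 2) = 0"
  by (simp add: hf_def xx_def pser_0)

section \<open>Reduction to iterated integrals\<close>

text \<open>Each \<open>hE\<close> contains an odd number of forms \<open>d\<theta>\<close>, each \<open>hf\<close> an even number; hence the
  factor \<open>\<i>\<close> appears only in the first representation.\<close>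

definition hE_rep :: "nat list \<Rightarrow> bool" where
  "hE_rep ts \<longleftrightarrow> (\<exists>p. lspan (Suc (sum_list ts)) p \<and>
    (\<forall>t. 0 \<le> t \<longrightarrow> t < 1 \<longrightarrow> of_real (hE ts t) = \<i> * pser p (of_real t)))"

definition hf_rep :: "nat list \<Rightarrow> bool" where
  "hf_rep ts \<longleftrightarrow> (\<exists>p. lspan (sum_list ts) p \<and>
    (\<forall>t. 0 \<le> t \<longrightarrow> t < 1 \<longrightarrow> of_real (hf ts (xx t ^ 2)) = pser p (of_real t)))"

lemma hE_rep_of_hf_rep:
  assumes ts: "\<forall>t\<in>set ts. t \<ge> 1" and "hf_rep ts"
  shows "hE_rep ts"
proof -
  obtain p where p: "lspan (sum_list ts) p"
    "\<And>t. 0 \<le> t \<Longrightarrow> t < 1 \<Longrightarrow> of_real (hf ts (xx t ^ 2)) = pser p (of_real t)"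
    using assms by (auto simp: hf_rep_def)
  \<comment> \<open>The sign makes up for \<open>\<i>\<close> * \<open>\<i>\<close> = -1: one factor
    comes from the claim and one from \<open>int_theta\<close>.\<close>
  let ?P = "\<lambda>n. of_int (-1) * int_theta p n"
  have l: "lspan (Suc (sum_list ts)) ?P" by (intro lspan_scale_int lspan_int_theta p)
  have "of_real (hE ts t) = \<i> * pser ?P (of_real t)" if t: "0 \<le> t" "t < 1" for t
  proof (rule eq_pser_if_deriv_eq[OF lspan_slow[OF l] hE_cont[OF ts] hE_deriv[OF ts]
        pser_deriv_cmult[OF lspan_slow[OF lspan_int_theta[OF p(1)]] _ int_theta_deriv[OF p(1)]] _ _ t])
    fix u :: real assume u: "0 < u" "u < 1"
    show "complex_of_real (2 / (1 + u ^ 2) * hf ts (xx u ^ 2)) =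
       \<i> * (of_int (-1) * (\<i> * (2 / (1 + (complex_of_real u) ^ 2)) * pser p (complex_of_real u)))"
      using p(2)[of u] u by (simp add: mult.assoc[symmetric])
  qed (use lspan_at_0[OF lspan_int_theta[OF p(1)]] in \<open>auto simp: hE_0\<close>)
  with l show ?thesis unfolding hE_rep_def by blast
qed

text \<open>The differential of \<open>hE (1 # ts)\<close> is 2 tan \<theta> \<open>hE ts\<close>
  d\<theta>, so one tangent form leads from \<open>hE\<close> to \<open>hE\<close> without a
  representation of \<open>hf (1 # ts)\<close>.\<close>

lemma hE_rep_Cons_1:
  assumes ts: "\<forall>t\<in>set ts. t \<ge> 1" and "hE_rep ts"
  shows "hE_rep (1 # ts)"
proof -
  obtain p where p: "lspan (Suc (sum_list ts)) p"
    "\<And>t. 0 \<le> t \<Longrightarrow> t < 1 \<Longrightarrow> of_real (hE ts t) = \<i> * pser p (of_real t)"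
    using assms by (auto simp: hE_rep_def)
  have ts1: "\<forall>t\<in>set (1 # ts). t \<ge> 1" using ts by simp
  let ?P = "\<lambda>n. of_int 2 * int_tan p n"
  have l: "lspan (Suc (Suc (sum_list ts))) ?P" by (intro lspan_scale_int lspan_int_tan p)
  have "of_real (hE (1 # ts) t) = \<i> * pser ?P (of_real t)" if t: "0 \<le> t" "t < 1" for t
  proof (rule eq_pser_if_deriv_eq[OF lspan_slow[OF l] hE_cont[OF ts1] hE_deriv[OF ts1]
        pser_deriv_cmult[OF lspan_slow[OF lspan_int_tan[OF p(1)]] _ int_tan_deriv[OF p(1)]] _ _ t])
    fix u :: real assume u: "0 < u" "u < 1"
    have ne: "1 - u ^ 2 \<noteq> 0" "1 + u ^ 2 \<noteq> 0"
      using u one_plus_square_pos[of u] by (auto simp: power2_eq_1_iff)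
    have "hf (1 # ts) (xx u ^ 2) = 2 * xx u / cc u * hE ts u"
      using hf_1_eq_hE[OF ts, of u] u ne by (simp add: cc_def field_simps)
    also have "2 / (1 + u ^ 2) * \<dots> = 2 * (4 * u / ((1 - u ^ 2) * (1 + u ^ 2))) * hE ts u"
    proof -
      have "2 / D * (2 * (2 * u / D) / (N / D) * h) = 2 * (4 * u / (N * D)) * h"
        if "N \<noteq> 0" "D \<noteq> 0" for N D h :: real
        using that by (simp add: field_simps)
      then show ?thesis unfolding cc_def xx_def using ne by blast
    qed
    finally have "complex_of_real (2 / (1 + u ^ 2) * hf (1 # ts) (xx u ^ 2)) =
      of_real (2 * (4 * u / ((1 - u ^ 2) * (1 + u ^ 2)))) * of_real (hE ts u)" by simp
    then show "complex_of_real (2 / (1 + u ^ 2) * hf (1 # ts) (xx u ^ 2)) =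
       \<i> * (of_int 2 * (4 * of_real u / ((1 - (of_real u) ^ 2) * (1 + (of_real u) ^ 2)) * pser p (of_real u)))"
      using p(2)[of u] u by simp
  qed (use lspan_at_0[OF lspan_int_tan[OF p(1)]] in \<open>auto simp: hE_0\<close>)
  with l show ?thesis unfolding hE_rep_def by auto
qed

text \<open>The cotangent from lowering the exponent cancels the tangent in
  \<open>hf (1 # ts)\<close>, leaving 4 \<open>hE ts\<close> d\<theta>. The \<open>\<i>\<close> of
  the representation of \<open>hE\<close> is absorbed by \<open>int_theta\<close>.\<close>

lemma hf_rep_Cons_2:
  assumes ts: "\<forall>t\<in>set ts. t \<ge> 1" and "hE_rep ts"
  shows "hf_rep (2 # ts)"
proof -
  obtain p where p: "lspan (Suc (sum_list ts)) p"
    "\<And>t. 0 \<le> t \<Longrightarrow> t < 1 \<Longrightarrow> of_real (hE ts t) = \<i> * pser p (of_real t)"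
    using assms by (auto simp: hE_rep_def)
  let ?P = "\<lambda>n. of_int 4 * int_theta p n"
  have l: "lspan (Suc (Suc (sum_list ts))) ?P" by (intro lspan_scale_int lspan_int_theta p)
  have "of_real (hf (Suc 1 # ts) (xx t ^ 2)) = 1 * pser ?P (of_real t)" if t: "0 \<le> t" "t < 1" for t
  proof (rule eq_pser_if_deriv_eq[OF lspan_slow[OF l] hf_xx_cont[OF ts] hf_xx_deriv[OF ts]
        pser_deriv_cmult[OF lspan_slow[OF lspan_int_theta[OF p(1)]] _ int_theta_deriv[OF p(1)]] _ _ t])
    fix u :: real assume u: "0 < u" "u < 1"
    have ne: "1 - u ^ 2 \<noteq> 0" "1 + u ^ 2 \<noteq> 0"
      using u one_plus_square_pos[of u] by (auto simp: power2_eq_1_iff)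
    have "hf (1 # ts) (xx u ^ 2) = 2 * xx u / cc u * hE ts u"
      using hf_1_eq_hE[OF ts, of u] u ne by (simp add: cc_def field_simps)
    also have "2 * ((1 - u ^ 2) / (u * (1 + u ^ 2))) * \<dots> = 4 * (2 / (1 + u ^ 2)) * hE ts u"
    proof -
      have "2 * (N / (u * D)) * (2 * (2 * u / D) / (N / D) * h) = 4 * (2 / D) * h"
        if "N \<noteq> 0" "D \<noteq> 0" for N D h :: real
        using that u by (simp add: field_simps)
      then show ?thesis unfolding cc_def xx_def using ne by blast
    qed
    finally have "complex_of_real (2 * ((1 - u ^ 2) / (u * (1 + u ^ 2))) * hf (1 # ts) (xx u ^ 2)) =
      of_real (4 * (2 / (1 + u ^ 2))) * of_real (hE ts u)" by simp
    then show "complex_of_real (2 * ((1 - u ^ 2) / (u * (1 + u ^ 2))) * hf (1 # ts) (xx u ^ 2)) =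
       1 * (of_int 4 * (\<i> * (2 / (1 + (of_real u) ^ 2)) * pser p (of_real u)))"
      using p(2)[of u] u by simp
  qed (use lspan_at_0[OF lspan_int_theta[OF p(1)]] in \<open>auto simp: hf_xx_0\<close>)
  with l show ?thesis unfolding hf_rep_def by (auto simp: numeral_2_eq_2)
qed

lemma hf_rep_Cons_Suc:
  assumes ts: "\<forall>t\<in>set ts. t \<ge> 1" and "s \<ge> 1" "hf_rep (s # ts)"
  shows "hf_rep (Suc s # ts)"
proof -
  obtain p where p: "lspan (sum_list (s # ts)) p"
    "\<And>t. 0 \<le> t \<Longrightarrow> t < 1 \<Longrightarrow> of_real (hf (s # ts) (xx t ^ 2)) = pser p (of_real t)"
    using assms by (auto simp: hf_rep_def)
  have W: "sum_list (s # ts) \<ge> 1" using assms by simp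
  let ?P = "\<lambda>n. of_int 2 * int_cot p n"
  have l: "lspan (Suc (sum_list (s # ts))) ?P" by (intro lspan_scale_int lspan_int_cot p W)
  have "of_real (hf (Suc s # ts) (xx t ^ 2)) = 1 * pser ?P (of_real t)" if t: "0 \<le> t" "t < 1" for t
  proof (rule eq_pser_if_deriv_eq[OF lspan_slow[OF l] hf_xx_cont[OF ts] hf_xx_deriv[OF ts]
        pser_deriv_cmult[OF lspan_slow[OF lspan_int_cot[OF p(1)]] _ int_cot_deriv[OF p(1)]] _ _ t])
    fix u :: real assume u: "0 < u" "u < 1"
    show "complex_of_real (2 * ((1 - u ^ 2) / (u * (1 + u ^ 2))) * hf (s # ts) (xx u ^ 2)) =
       1 * (of_int 2 * ((1 - (of_real u) ^ 2) / (of_real u * (1 + (of_real u) ^ 2)) * pser p (of_real u)))"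
      using p(2)[of u] u by (simp flip: p(2))
  qed (use lspan_at_0[OF lspan_int_cot[OF p(1)]] assms W in \<open>auto simp: hf_xx_0\<close>)
  with l show ?thesis unfolding hf_rep_def by auto
qed

lemma hf_rep_Cons:
  assumes "\<forall>t\<in>set ts. t \<ge> 1" "hE_rep ts" "s \<ge> 2"
  shows "hf_rep (s # ts)"
  using assms(3)
  by (induction s rule: dec_induct) (use assms hf_rep_Cons_2 hf_rep_Cons_Suc in auto)

lemma hf_rep_Nil: "hf_rep []"
proof -
  have "lspan 0 (lseq [])" using lspan.gen[of "[]"] by simp
  moreover have "hf [] y = 1" for y
  proof -
    have "(\<lambda>n. hseq [] n * bc n * y ^ n) = (\<lambda>n. if n = 0 then 1 else 0)"
      by (auto simp: bc_0)
    then show ?thesis using sums_single[of 0 "\<lambda>_. 1::real"] unfolding hf_def pser_def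
      by (simp add: sums_iff)
  qed
  moreover have "pser (lseq []) z = 1" for z
  proof -
    have "(\<lambda>n. lseq [] n * z ^ n) = (\<lambda>n. if n = 0 then 1 else 0)"
      by auto
    then show ?thesis using sums_single[of 0 "\<lambda>_. 1::complex"] unfolding pser_def
      by (simp add: sums_iff)
  qed
  ultimately show ?thesis unfolding hf_rep_def by (intro exI[of _ "lseq []"]) simp
qed

text \<open>A leading 1 is a single tangent step. A larger leading exponent passes through
  \<open>hf\<close> and returns to \<open>hE\<close> with one more d\<theta>.\<close>

lemma hE_rep: "\<forall>t\<in>set ts. t \<ge> 1 \<Longrightarrow> hE_rep ts"
proof (induction ts)
  case Nil
  then show ?case by (intro hE_rep_of_hf_rep hf_rep_Nil) auto
next
  case (Cons s ts)
  show ?case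
  proof (cases "s = 1")
    case True
    with Cons hE_rep_Cons_1[of ts] show ?thesis by simp
  next
    case False
    with Cons have "hf_rep (s # ts)" by (intro hf_rep_Cons) auto
    with Cons show ?thesis by (intro hE_rep_of_hf_rep) auto
  qed
qed

section \<open>The second central binomial coefficient\<close>

text \<open>The antiderivative of \<open>sin\<^bsup>2n+1\<^esup> \<theta> d\<theta>\<close> vanishing at 0, by the reduction formula.\<close>

fun sin_int :: "nat \<Rightarrow> real \<Rightarrow> real" where
  "sin_int 0 t = 1 - cc t"
| "sin_int (Suc n) t = ((2 * real n + 2) * sin_int n t - xx t ^ (2 * n + 2) * cc t) / (2 * real n + 3)"

lemma sin_int_deriv:
  "(sin_int n has_real_derivative xx t ^ (2 * n + 1) * (2 / (1 + t ^ 2))) (at t)"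
proof (induction n)
  case 0
  show ?case by (auto intro!: derivative_eq_intros cc_deriv)
next
  case (Suc n)
  let ?w = "2 / (1 + t ^ 2)"
  have "(sin_int (Suc n) has_real_derivative
      ((2 * real n + 2) * (xx t ^ (2 * n + 1) * ?w) -
       (real (2 * n + 2) * (cc t * ?w * xx t ^ (2 * n + 2 - Suc 0)) * cc t + - xx t * ?w * xx t ^ (2 * n + 2)))
       / (2 * real n + 3)) (at t)"
    unfolding sin_int.simps
    by (intro DERIV_cdivide DERIV_diff DERIV_cmult DERIV_mult DERIV_power Suc cc_deriv xx_deriv)
  also have "((2 * real n + 2) * (xx t ^ (2 * n + 1) * ?w) -
       (real (2 * n + 2) * (cc t * ?w * xx t ^ (2 * n + 2 - Suc 0)) * cc t + - xx t * ?w * xx t ^ (2 * n + 2)))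
     = (2 * real n + 3) * (xx t ^ (2 * Suc n + 1) * ?w)"
  proof -
    have "(2 * N + 2) * (X * w) - ((2 * N + 2) * (c * w * X) * c + - x * w * (X * x)) =
        (2 * N + 3) * (X * x ^ 2 * w)" if "c ^ 2 = 1 - x ^ 2" for c x w X N :: real
      using that by algebra
    moreover have "xx t ^ (2 * n + 2) = xx t ^ (2 * n + 1) * xx t"
      "xx t ^ (2 * Suc n + 1) = xx t ^ (2 * n + 1) * xx t ^ 2"
      "2 * n + 2 - Suc 0 = 2 * n + 1" "real (2 * n + 2) = 2 * real n + 2"
      by (simp_all add: power2_eq_square)
    ultimately show ?thesis using cc_square[of t] by (simp only:)
  qed
  finally show ?case by simp
qed

lemma sin_int_0: "sin_int n 0 = 0"
  by (induction n) (auto simp: cc_def xx_def)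

text \<open>Wallis' formula: t = 1 is \<theta> = \<pi>/2, where the cosine vanishes and the
  reduction formula becomes the recursion of \<open>bc\<close>.\<close>

lemma sin_int_1: "sin_int n 1 = bc (Suc n) / (2 * Suc n)"
proof (induction n)
  case 0
  show ?case by (simp add: cc_def bc_def)
next
  case (Suc n)
  have "sin_int (Suc n) 1 = bc (Suc n) / (2 * real n + 3)"
    using Suc by (simp add: cc_def add.commute[of 2])
  also have "\<dots> = bc (Suc (Suc n)) / (2 * Suc (Suc n))"
    by (simp add: bc_Suc[of "Suc n"] divide_simps)
  finally show ?case .
qed

lemma sin_int_bounds:
  assumes "0 \<le> t" "t \<le> 1"
  shows "0 \<le> sin_int n t" "sin_int n t \<le> sin_int n 1"
proof -
  have *: "sin_int n a \<le> sin_int n b" if "0 \<le> a" "a \<le> b" for a b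
  proof (rule DERIV_nonneg_imp_nondecreasing[OF that(2)])
    fix u assume "a \<le> u" "u \<le> b"
    then have "xx u ^ (2 * n + 1) * (2 / (1 + u ^ 2)) \<ge> 0"
      using that xx_bounds(1)[of u] one_plus_square_pos[of u] by simp
    then show "\<exists>y. (sin_int n has_real_derivative y) (at u) \<and> 0 \<le> y"
      using sin_int_deriv by blast
  qed
  show "0 \<le> sin_int n t" using *[of 0 t] assms by (simp add: sin_int_0)
  show "sin_int n t \<le> sin_int n 1" using *[of t 1] assms by simp
qed

text \<open>The square of \<open>bc\<close> costs one power of n, so s >= 3 leaves a term dominated
  by \<open>hseq (1 # ts)\<close> over n. The constant 5 comes from 4 n + 1 <= 5 n for n >=
  1.\<close>

lemma summable_hseq_bc_square:
  assumes ts: "\<forall>t\<in>set ts. t \<ge> 1" and s: "s \<ge> 3"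
  shows "summable (\<lambda>n. hseq (s # ts) (Suc n) * bc (Suc n) ^ 2)"
proof -
  have "\<forall>t\<in>set (1 # ts). t \<ge> 1" using ts by simp
  from slow_imp_summable_div[OF slow_hseq[OF this]]
  have summ: "summable (\<lambda>n. 5 * norm (hseq (1 # ts) (Suc n) / real (Suc n)))"
    by (subst (asm) summable_Suc_iff[symmetric]) (rule summable_mult)
  have "norm (hseq (s # ts) (Suc n) * bc (Suc n) ^ 2) \<le>
      5 * norm (hseq (1 # ts) (Suc n) / real (Suc n))" for n
  proof -
    let ?h = "hseq (1 # ts) (Suc n)"
    let ?N = "real (Suc n)"
    have h: "?h \<ge> 0" by (rule hseq_nonneg)
    have "hseq (s # ts) (Suc n) = ?h / ?N ^ (s - 1)"
      using s by (simp add: power_eq_if)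
    also have "\<dots> \<le> ?h / ?N ^ 2"
      using s h by (intro divide_left_mono power_increasing) auto
    finally have "hseq (s # ts) (Suc n) \<le> ?h / ?N ^ 2" .
    moreover have "bc (Suc n) ^ 2 \<le> 5 * ?N" using bc_square_le[of "Suc n"] by simp
    ultimately have "hseq (s # ts) (Suc n) * bc (Suc n) ^ 2 \<le> ?h / ?N ^ 2 * (5 * ?N)"
      using h by (intro mult_mono) (auto simp del: hseq.simps of_nat_Suc)
    also have "\<dots> = 5 * (?h / ?N)"
      by (simp add: power2_eq_square del: hseq.simps of_nat_Suc)
    finally show ?thesis
      using hseq_nonneg[of "s # ts" "Suc n"] h by (simp add: abs_mult del: hseq.simps of_nat_Suc)
  qed
  then show ?thesis by (intro summable_comparison_test[OF _ summ] exI[of _ 0]) blast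
qed

text \<open>One factor \<open>bc\<close> stays inside \<open>hf\<close>, the other is replaced by a
  sine integral. Both sides are then values at t = 1 of functions with derivative 2
  \<open>hf (s # ts)\<close> / t.\<close>

lemma suminf_hseq_bc_square:
  assumes ts: "\<forall>t\<in>set ts. t \<ge> 1" and s: "s \<ge> 2"
    and p: "lspan W p" "W \<ge> 1"
      "\<And>t. 0 \<le> t \<Longrightarrow> t < 1 \<Longrightarrow> of_real (hf (s # ts) (xx t ^ 2)) = pser p (of_real t)"
  shows "complex_of_real (\<Sum>n. hseq (Suc s # ts) (Suc n) * bc (Suc n) ^ 2) = 2 * (\<Sum>n. int0 p n)"
proof -
  define c where "c n = hseq (s # ts) n * bc n" for n
  have sts: "\<forall>t\<in>set (s # ts). t \<ge> 1" using ts s by auto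
  have c0: "c n \<ge> 0" for n unfolding c_def using bc_pos[of n] hseq_nonneg[of "s # ts" n] by (simp del: hseq.simps)
  obtain C where C: "\<And>n. norm (c n) \<le> C" unfolding c_def using hf_coeff_bounded[OF sts] by blast
  have C0: "C \<ge> 0" using order_trans[OF norm_ge_zero C[of 0]] .
  \<comment> \<open>At t = 1 the factor \<open>sin_int\<close> supplies the second \<open>bc\<close>
    and a further division by n + 1, which raises the exponent s to \<open>Suc s\<close>.\<close>
  define f where "f n t = c (Suc n) * 2 * sin_int n t" for n t
  define G where "G t = (\<Sum>n. f n t)" for t
  have f1: "f n 1 = hseq (Suc s # ts) (Suc n) * bc (Suc n) ^ 2" for n
  proof -
    have "hseq (Suc s # ts) (Suc n) = hseq (s # ts) (Suc n) / real (Suc n)" by simp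
    then show ?thesis unfolding f_def c_def sin_int_1 of_nat_mult
      by (simp add: power2_eq_square del: hseq.simps of_nat_Suc)
  qed
  have sum1: "summable (\<lambda>n. f n 1)"
    unfolding f1 using s by (intro summable_hseq_bc_square ts) auto
  have fb: "norm (f n t) \<le> f n 1" if "t \<in> {0..1}" for n t
    unfolding f_def using that sin_int_bounds[of t n] c0[of "Suc n"]
    by (auto simp: abs_mult intro!: mult_left_mono mult_right_mono)
  have sumt: "summable (\<lambda>n. f n t)" if "t \<in> {0..1}" for t
    by (rule summable_comparison_test[OF _ sum1]) (use fb that in blast)
  have contG: "continuous_on {0..1} G"
  proof (rule uniform_limit_theorem)
    show "uniform_limit {0..1} (\<lambda>n t. \<Sum>i<n. f i t) G sequentially"
      unfolding G_def by (rule Weierstrass_m_test[OF fb sum1])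
    show "\<forall>\<^sub>F n in sequentially. continuous_on {0..1} (\<lambda>t. \<Sum>i<n. f i t)"
      unfolding f_def
      by (intro always_eventually allI continuous_intros continuous_at_imp_continuous_on ballI
          DERIV_isCont[OF sin_int_deriv])
  qed simp
  have dG: "(G has_real_derivative 2 * hf (s # ts) (xx t ^ 2) / t) (at t)" if t: "0 < t" "t < 1" for t
  proof -
    \<comment> \<open>The geometric majorant for the differentiated series has ratio \<rho> < 1 only
      on an interval bounded away from 1, hence the intermediate point r.\<close>
    obtain r where r: "t < r" "r < 1" using dense[OF t(2)] by blast
    define \<rho> where "\<rho> = 1 - (1 - r) ^ 2 / 2"
    have "0 < 1 - r" "1 - r < 1" using r t by auto
    then have "(1 - r) ^ 2 > 0" "(1 - r) ^ 2 < 1" by (auto simp: power_less_one_iff)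
    then have \<rho>: "0 < \<rho>" "\<rho> < 1" by (auto simp: \<rho>_def)
    have xb: "xx u \<le> \<rho>" if u: "u \<in> {0<..<r}" for u
    proof -
      have "u ^ 2 < 1" using u r by (simp add: power_less_one_iff)
      moreover have "(1 - r) ^ 2 \<le> (1 - u) ^ 2" using u r by (intro power_mono) auto
      ultimately have "(1 - r) ^ 2 / 2 \<le> (1 - u) ^ 2 / (1 + u ^ 2)"
        using one_plus_square_pos[of u] by (intro frac_le) auto
      then show ?thesis using xx_bounds(2)[of u] unfolding \<rho>_def by linarith
    qed
    define f' where "f' n u = c (Suc n) * 2 * (xx u ^ (2 * n + 1) * (2 / (1 + u ^ 2)))" for n u
    have f'b: "norm (f' n u) \<le> 4 * C * \<rho> ^ n" if u: "u \<in> {0<..<r}" for n u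
    proof -
      have x0: "xx u \<ge> 0" using xx_bounds(1)[of u] u by simp
      have "xx u ^ (2 * n + 1) \<le> \<rho> ^ (2 * n + 1)" using x0 xb[OF u] by (rule power_mono[rotated])
      also have "\<dots> \<le> \<rho> ^ n" using \<rho> by (intro power_decreasing) auto
      finally have 1: "xx u ^ (2 * n + 1) \<le> \<rho> ^ n" .
      have 2: "2 / (1 + u ^ 2) \<le> 2" using one_plus_square_pos[of u] by (simp add: divide_simps)
      have "norm (f' n u) = c (Suc n) * 2 * (xx u ^ (2 * n + 1) * (2 / (1 + u ^ 2)))"
        using c0[of "Suc n"] x0 one_plus_square_pos[of u] by (simp add: f'_def abs_mult)
      also have "\<dots> \<le> C * 2 * (\<rho> ^ n * 2)"
        using 1 2 C[of "Suc n"] C0 c0[of "Suc n"] x0 \<rho> one_plus_square_pos[of u]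
        by (intro mult_mono) auto
      finally show ?thesis by simp
    qed
    have sum\<rho>: "summable (\<lambda>n. 4 * C * \<rho> ^ n)"
      using \<rho> by (intro summable_mult summable_geometric) auto
    have "\<exists>g. \<forall>x\<in>{0<..<r}. (\<lambda>n. f n x) sums g x \<and>
        (g has_field_derivative (\<Sum>n. f' n x)) (at x within {0<..<r})"
    proof (rule has_field_derivative_series)
      show "uniform_limit {0<..<r} (\<lambda>n x. \<Sum>i<n. f' i x) (\<lambda>x. \<Sum>n. f' n x) sequentially"
        by (rule Weierstrass_m_test[OF f'b sum\<rho>])
      show "t \<in> {0<..<r}" using t r by simp
      show "summable (\<lambda>n. f n t)" using t by (intro sumt) simp
      show "(f n has_field_derivative f' n x) (at x within {0<..<r})" for n x
        unfolding f_def f'_def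
        by (intro DERIV_cmult has_field_derivative_at_within[OF sin_int_deriv])
    qed simp
    then obtain g where g: "\<And>x. x \<in> {0<..<r} \<Longrightarrow> (\<lambda>n. f n x) sums g x"
      "\<And>x. x \<in> {0<..<r} \<Longrightarrow> (g has_field_derivative (\<Sum>n. f' n x)) (at x within {0<..<r})"
      by blast
    have gG: "g x = G x" if "x \<in> {0<..<r}" for x
      unfolding G_def using g(1)[OF that] by (simp add: sums_iff)
    have gd: "(g has_field_derivative (\<Sum>n. f' n t)) (at t)"
    proof -
      have "t \<in> {0<..<r}" using t r by simp
      with g(2)[OF this] at_within_open[OF this] show ?thesis by simp
    qed
    have "(G has_field_derivative (\<Sum>n. f' n t)) (at t)"
      by (rule has_field_derivative_transform_within_open[OF gd open_greaterThanLessThan _ gG])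
        (use t r in simp)
    moreover have "(\<Sum>n. f' n t) = 2 * hf (s # ts) (xx t ^ 2) / t"
    proof -
      have "norm (xx t ^ 2) < 1" using xx_bounds(3)[of t] t by simp
      from pser_sums[OF C this]
      have "(\<lambda>n. c n * (xx t ^ 2) ^ n) sums hf (s # ts) (xx t ^ 2)"
        unfolding hf_def c_def .
      then have "(\<lambda>n. c (Suc n) * (xx t ^ 2) ^ Suc n) sums hf (s # ts) (xx t ^ 2)"
        by (subst sums_Suc_iff) (simp add: c_def)
      then have "(\<lambda>n. 2 / t * (c (Suc n) * (xx t ^ 2) ^ Suc n)) sums (2 / t * hf (s # ts) (xx t ^ 2))"
        by (rule sums_mult)
      moreover have "2 / t * (c (Suc n) * (xx t ^ 2) ^ Suc n) = f' n t" for n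
      proof -
        \<comment> \<open>This is d\<theta> / sin \<theta> = dt / t; it completes the odd power of
          the sine to a power of sin^2 \<theta>.\<close>
        have "xx t / t = 2 / (1 + t ^ 2)" using t by (simp add: xx_def)
        moreover have "(xx t ^ 2) ^ Suc n = xx t ^ (2 * n + 1) * xx t"
          unfolding power_mult[symmetric] by simp
        ultimately have "f' n t = c (Suc n) * 2 * (xx t ^ (2 * n + 1) * (xx t / t))"
          "2 / t * (c (Suc n) * (xx t ^ 2) ^ Suc n) = 2 / t * (c (Suc n) * (xx t ^ (2 * n + 1) * xx t))"
          unfolding f'_def by (simp_all only:)
        then show ?thesis by (simp only: times_divide_eq_left times_divide_eq_right mult_ac)
      qed
      ultimately have "(\<lambda>n. f' n t) sums (2 / t * hf (s # ts) (xx t ^ 2))" by (simp only:)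
      from sums_unique[OF this] show ?thesis by simp
    qed
    ultimately show ?thesis by simp
  qed
  let ?P = "\<lambda>n. of_int 2 * int0 p n"
  have l: "lspan (Suc W) ?P" by (intro lspan_scale_int lspan_int0 p)
  have eq: "of_real (G t) = 1 * pser ?P (of_real t)" if t: "0 \<le> t" "t < 1" for t
  proof (rule eq_pser_if_deriv_eq[OF lspan_slow[OF l] _ dG
        pser_deriv_cmult[OF lspan_slow[OF lspan_int0[OF p(1,2)]] _ lspan_int0_deriv[OF p(1,2)]] _ _ t])
    show "continuous_on {0..<1} G" by (rule continuous_on_subset[OF contG]) auto
    show "complex_of_real (2 * hf (s # ts) (xx u ^ 2) / u) =
       1 * (of_int 2 * (pser p (of_real u) / of_real u))" if "0 < u" "u < 1" for u
      using p(3)[of u] that by simp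
    show "complex_of_real (G 0) = 1 * (of_int 2 * int0 p 0)"
      by (simp add: G_def f_def sin_int_0 int0_def)
  qed auto
  have sP: "summable (\<lambda>n. norm (?P n))"
    using summable_mult[OF summable_int0[OF p(1)], of 2] by (simp add: norm_mult)
  have contP: "continuous_on {0..1} (\<lambda>t. pser ?P (complex_of_real t))"
  proof (rule uniform_limit_theorem)
    show "uniform_limit {0..1} (\<lambda>n t. \<Sum>i<n. ?P i * complex_of_real t ^ i)
       (\<lambda>t. pser ?P (complex_of_real t)) sequentially"
      unfolding pser_def
    proof (rule Weierstrass_m_test[OF _ sP])
      fix n and t :: real assume "t \<in> {0..1}"
      then have "norm (?P n) * \<bar>t\<bar> ^ n \<le> norm (?P n) * 1"
        by (intro mult_left_mono power_le_one) auto
      then show "norm (?P n * complex_of_real t ^ n) \<le> norm (?P n)"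
        by (simp add: norm_mult norm_power)
    qed
    show "\<forall>\<^sub>F n in sequentially. continuous_on {0..1} (\<lambda>t. \<Sum>i<n. ?P i * complex_of_real t ^ i)"
      by (intro always_eventually allI continuous_intros)
  qed simp
  \<comment> \<open>The identity is known for t < 1 only; both sides are continuous on the closed
    interval by uniform convergence, so left limits agree.\<close>
  have "complex_of_real (G 1) = pser ?P (of_real 1)"
  proof (rule tendsto_unique)
    have e: "\<forall>\<^sub>F t in at_left (1::real). t \<in> {0<..<1}"
      by (rule eventually_at_leftI[of 0]) auto
    have "(G \<longlongrightarrow> G 1) (at_left 1)"
      using contG by (simp add: continuous_on_Icc_at_leftD)
    then show "((\<lambda>t. complex_of_real (G t)) \<longlongrightarrow> complex_of_real (G 1)) (at_left 1)"
      by (rule tendsto_of_real)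
    have "((\<lambda>t. pser ?P (complex_of_real t)) \<longlongrightarrow> pser ?P (complex_of_real 1)) (at_left 1)"
      using continuous_on_Icc_at_leftD[OF contP] by simp
    then show "((\<lambda>t. complex_of_real (G t)) \<longlongrightarrow> pser ?P (complex_of_real 1)) (at_left 1)"
      by (rule Lim_transform_eventually) (use e eq in \<open>auto elim!: eventually_mono\<close>)
  qed simp
  moreover have "pser ?P (of_real 1) = 2 * (\<Sum>n. int0 p n)"
    using suminf_mult[OF summable_norm_cancel[OF summable_int0[OF p(1)]], of 2]
    by (simp add: pser_def)
  ultimately show ?thesis by (simp only: G_def f1)
qed

theorem theorem4p15:
  fixes w :: "letter list" and s :: nat
  assumes "admissible_word w" and "s \<ge> 3"
  shows "(\<Sum>n. Hsum n w / (of_nat (Suc n)) ^ s *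
            inverse (of_real (real (binomial (2 * Suc n) (Suc n)) / 4 ^ Suc n)) ^ 2 :: complex)
         \<in> CMZV 4 (s + weight w)"
proof -
  define ts where "ts = word_comp w"
  have ts: "\<forall>t\<in>set ts. t \<ge> 1" using comp_aux_pos[of _ 0 w] by (auto simp: ts_def word_comp_def)
  \<comment> \<open>The second binomial integral accounts for one unit of s, and the representation
    of \<open>hf\<close> needs the remaining exponent to be at least 2.\<close>
  obtain r where r: "s = Suc r" "r \<ge> 2" using assms(2) by (cases s) auto
  obtain p where p: "lspan (sum_list (r # ts)) p"
    "\<And>t. 0 \<le> t \<Longrightarrow> t < 1 \<Longrightarrow> of_real (hf (r # ts) (xx t ^ 2)) = pser p (of_real t)"
    using hf_rep_Cons[OF ts hE_rep[OF ts] r(2)] unfolding hf_rep_def by blast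
  have W: "sum_list (r # ts) \<ge> 1" using r by simp
  have summ: "summable (\<lambda>n. hseq (s # ts) (Suc n) * bc (Suc n) ^ 2)"
    by (rule summable_hseq_bc_square[OF ts assms(2)])
  have term_eq: "Hsum n w / (of_nat (Suc n)) ^ s *
      inverse (of_real (real (binomial (2 * Suc n) (Suc n)) / 4 ^ Suc n)) ^ 2 =
      complex_of_real (hseq (s # ts) (Suc n) * bc (Suc n) ^ 2)" for n
  proof -
    have "inverse (of_real (real (binomial (2 * Suc n) (Suc n)) / 4 ^ Suc n)) = complex_of_real (bc (Suc n))"
      unfolding bc_def by (simp only: of_real_inverse[symmetric] inverse_divide)
    moreover have "Hsum n w / (of_nat (Suc n)) ^ s = complex_of_real (hseq (s # ts) (Suc n))"
      by (simp add: Hsum_eq_sum_hseq ts_def lessThan_Suc_atMost del: sum.lessThan_Suc)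
    ultimately show ?thesis by (simp only: of_real_mult of_real_power)
  qed
  have "(\<Sum>n. Hsum n w / (of_nat (Suc n)) ^ s *
            inverse (of_real (real (binomial (2 * Suc n) (Suc n)) / 4 ^ Suc n)) ^ 2 :: complex) =
      complex_of_real (\<Sum>n. hseq (Suc r # ts) (Suc n) * bc (Suc n) ^ 2)"
    unfolding term_eq using suminf_of_real[OF summ, where 'a = complex] by (simp only: r)
  also have "\<dots> = of_real (of_rat 2) * (\<Sum>n. int0 p n)"
    using suminf_hseq_bc_square[OF ts r(2) p(1) W p(2)] by simp
  also have "\<dots> \<in> CMZV 4 (Suc (sum_list (r # ts)))"
    by (intro CMZV_scale suminf_int0_in_CMZV[OF p(1) W])
  also have "Suc (sum_list (r # ts)) = s + weight w"
    by (simp add: r weight_def ts_def)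
  finally show ?thesis .
qed

end
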